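(* Let $g$ be a Gårding polynomial of degree $N\ge1$ with Gårding cone $\Gamma$ on a finite-dimensional real inner product space $V$, let $E$ be the edge of $\Gamma$, $\Gamma^*$ its open polar and $g^*:\Gamma^*\to\mathbb{R}$ the dual Gårding function. (1) For all $A\in\Gamma$ and $B\in\Gamma^*$, $$g(A)^{1/N}\,g^*(B)^{1/N}\ \le\ \frac1N\langle A,B\rangle,$$ with equality if and only if $B\equiv\lambda\,D_A\log g$ modulo $E$ for some $\lambda>0$, in which case $\langle A,B\rangle=\lambda N$. (2) For all $A\in\Gamma$ and all $B\in\Gamma^*$ with $g^*(B)=1$, $$g(A)^{1/N}\ \le\ \frac1N\langle B,A\rangle,$$ with equality if and only if $B\equiv D_A\, g^{1/N}$ modulo $E$. (3) For all $A\in\overline\Gamma$, $$g(A)^{1/N}\ =\ \inf_{B\in\Gamma^*,\ g^*(B)=1}\ \frac1N\langle B,A\rangle .$$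
   Context: A Gårding polynomial of degree $N$ on a finite-dimensional real vector space $V$ is a homogeneous real polynomial $g$ of degree $N$ on $V$ together with a connected component $\Gamma$ of $\{g>0\}$ (the Gårding cone) such that for some $e\in\Gamma$ and every $v\in V$ the polynomial $t\mapsto g(te+v)$ has exactly $N$ real roots counted with multiplicity. The cone $\Gamma$ is then open and convex. Its edge is the linear subspace $E=\overline\Gamma\cap(-\overline\Gamma)$, and $g(x+v)=g(x)$ for all $x\in V$, $v\in E$. The dual $V^*$ is identified with $V$ by the inner product, so derivatives $D_A$ are gradients in $V$. The polar is $\Gamma^0=\{y\in V:\langle y,x\rangle\ge0\ \forall x\in\Gamma\}$, with span $S=E^\perp$, and the open polar $\Gamma^*$ is the interior of $\Gamma^0$ relative to $S$. For $x\in\Gamma$ put $F(x)=D_x\log g$. This depends only on $x$ modulo $E$, and $F$ induces a bijection $\Gamma/E\to\Gamma^*$. The dual Gårding function is $g^*(y)=1/g(x)$ for $y\in\Gamma^*$, where $x\in\Gamma$ is any point with $F(x)=y$.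
   Formalization: In (2) the equality condition is corrected to B ≡ N·D_A g^{1/N} modulo E; the printed B ≡ D_A g^{1/N} fails for N ≥ 2 (e.g. g(x)=x² on ℝ, where g*(B)=1 forces B=2 and equality always holds, but D_A g^{1/2}=1). *)

theory Defs
  imports "HOL-Analysis.Analysis" "HOL-Computational_Algebra.Computational_Algebra"
begin

(* Over the reals, a polynomial function is a homogeneous polynomial of degree N iff it is
   homogeneous of degree N as a function. *)
definition homogeneous_polynomial :: "nat \<Rightarrow> ('a::euclidean_space \<Rightarrow> real) \<Rightarrow> bool" where
  "homogeneous_polynomial N g \<longleftrightarrow>
     real_polynomial_function g \<and> (\<forall>c x. g (c *\<^sub>R x) = c ^ N * g x)"

(* proots p is the multiset of real roots of p, so its size counts them with multiplicity. *)
definition garding_polynomial :: "nat \<Rightarrow> ('a::euclidean_space \<Rightarrow> real) \<Rightarrow> 'a set \<Rightarrow> bool" where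
  "garding_polynomial N g \<Gamma> \<longleftrightarrow>
     homogeneous_polynomial N g \<and>
     \<Gamma> \<in> components {x. g x > 0} \<and>
     (\<exists>e\<in>\<Gamma>. \<forall>v. \<exists>p :: real poly.
        (\<forall>t. poly p t = g (t *\<^sub>R e + v)) \<and> p \<noteq> 0 \<and> size (proots p) = N)"

definition edge :: "'a::euclidean_space set \<Rightarrow> 'a set" where
  "edge \<Gamma> = closure \<Gamma> \<inter> uminus ` closure \<Gamma>"

definition polar_cone :: "'a::euclidean_space set \<Rightarrow> 'a set" where
  "polar_cone \<Gamma> = {y. \<forall>x\<in>\<Gamma>. y \<bullet> x \<ge> 0}"

definition open_polar :: "'a::euclidean_space set \<Rightarrow> 'a set" where
  "open_polar \<Gamma> = (top_of_set (span (polar_cone \<Gamma>))) interior_of (polar_cone \<Gamma>)"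

(* The derivative of f at x, identified with a vector by the inner product; meaningful only
   where f is differentiable. *)
definition gradient :: "('a::euclidean_space \<Rightarrow> real) \<Rightarrow> 'a \<Rightarrow> 'a" where
  "gradient f x = (THE D. GDERIV f x :> D)"

(* The value does not depend on the point x with D_x log g = y; meaningful for y in the open
   polar only. *)
definition dual_garding :: "('a::euclidean_space \<Rightarrow> real) \<Rightarrow> 'a set \<Rightarrow> 'a \<Rightarrow> real" where
  "dual_garding g \<Gamma> y =
     (THE r. \<exists>x\<in>\<Gamma>. gradient (\<lambda>z. ln (g z)) x = y \<and> r = 1 / g x)"

(* If g has degree N, then y = c *\<^sub>R gradient (ln g) A with c > 0 has dual value c ^ N / g A.
   Hence the multiple with dual value 1 is g(A)^(1/N) times the gradient of ln g at A, which is
   N times the gradient of g^(1/N) at A. *)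

end

theory Submission
  imports Defs
begin

text \<open>Let \<open>x\<close> and \<open>a\<close> lie in the Garding cone. Then \<open>t \<mapsto> g (t *\<^sub>R x + a)\<close> is
  \<open>g x\<close> times a product of \<open>N\<close> factors \<open>t + l i\<close> with all eigenvalues \<open>l i\<close> positive. Their
  product is \<open>g a / g x\<close>, and their sum is \<open>a \<bullet> B\<close>, where \<open>B\<close> is the gradient of \<open>ln g\<close> at \<open>x\<close>.
  As the dual function takes the value \<open>1 / g x\<close> at \<open>B\<close>, the main inequality is the one between
  the geometric and the arithmetic mean of the eigenvalues (\<open>root_le_inner_grad_log\<close>). Equality
  holds only if all eigenvalues coincide; then \<open>a\<close> is a positive multiple of \<open>x\<close> modulo the edge,
  and \<open>B\<close> is a positive multiple of the gradient of \<open>ln g\<close> at \<open>a\<close>.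

  Two facts have to be supplied for this. First, the polynomials above must be real-rooted for every
  base point \<open>x\<close> in the cone, while the hypothesis provides only one such point \<open>e\<close>. This is
  Garding's theorem (\<open>hyperbolic_in_cone\<close>), proved by following complex roots along a path from
  \<open>\<i> e\<close> to a given real vector: the roots cannot cross the real axis. It also yields the
  convexity of the cone and the description of the edge by vanishing eigenvalues. Secondly, every
  point of the open polar must be such a gradient (\<open>grad_log_surj\<close>); the preimage maximizes \<open>g\<close>
  on a compact slice of the closed cone.

  The second claim restates the first for dual value \<open>1\<close>, since
  \<open>N\<close> times the gradient of the \<open>N\<close>-th root of \<open>g\<close> is that root times the gradient of
  \<open>ln g\<close>. The third one follows because equality is attained in the open cone, and because both
  the inequality and the bound by attained values pass to the closure (\<open>root_eq_INF\<close>).\<close>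

section \<open>Real-rooted polynomials and the arithmetic-geometric mean\<close>

lemma poly_eq_if_agree_on_reals:
  fixes p q :: "complex poly"
  assumes "\<And>t::real. poly p (of_real t) = poly q (of_real t)"
  shows "poly p z = poly q z"
proof -
  have "range complex_of_real \<subseteq> {x. poly (p - q) x = 0}"
    using assms by auto
  moreover have "infinite (range complex_of_real)"
    by (simp add: finite_image_iff inj_of_real infinite_UNIV_char_0)
  ultimately have "p - q = 0"
    by (metis finite_subset poly_roots_finite)
  then show ?thesis by simp
qed

text \<open>Restricting a homogeneous form \<open>g\<close> of degree \<open>N\<close> to a line gives
  \<open>p t = g (t *\<^sub>R a + x)\<close>, and homogeneity ties it to \<open>q s = g (a + s *\<^sub>R x)\<close> by the
  relation assumed here. So the degree and the leading coefficient of \<open>p\<close> come for free once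
  \<open>g a\<close> does not vanish.\<close>
lemma degree_lead_coeff_of_reversal:
  fixes p q :: "'a::field_char_0 poly"
  assumes rev: "\<And>t. t \<noteq> 0 \<Longrightarrow> poly p t = t ^ N * poly q (inverse t)"
    and q0: "poly q 0 \<noteq> 0"
  shows "degree p = N" "lead_coeff p = poly q 0"
proof -
  have "poly (monom 1 (degree q) * p) t = poly (monom 1 N * reflect_poly q) t" if "t \<noteq> 0" for t
    using that by (simp add: poly_monom rev poly_reflect_poly_nz)
  then have "UNIV - {0} \<subseteq> {t. poly (monom 1 (degree q) * p - monom 1 N * reflect_poly q) t = 0}"
    by auto
  moreover have "infinite (UNIV - {0::'a})"
    by (simp add: infinite_UNIV_char_0)
  ultimately have eq: "monom 1 (degree q) * p = monom 1 N * reflect_poly q"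
    by (metis finite_subset poly_roots_finite eq_iff_diff_eq_0)
  have c0: "coeff q 0 \<noteq> 0" using q0 by (simp add: poly_0_coeff_0)
  then have "q \<noteq> 0" by auto
  then have "p \<noteq> 0" using eq by auto
  have "degree q + degree p = N + degree q"
    using arg_cong[OF eq, of degree] \<open>p \<noteq> 0\<close> \<open>q \<noteq> 0\<close> c0
    by (simp add: degree_mult_eq degree_monom_eq)
  then show "degree p = N" by simp
  have "lead_coeff p = lead_coeff (reflect_poly q)"
    using arg_cong[OF eq, of lead_coeff] by (simp add: lead_coeff_mult degree_monom_eq)
  also have "\<dots> = poly q 0"
    using c0 by (simp add: coeff_reflect_poly poly_0_coeff_0)
  finally show "lead_coeff p = poly q 0" .
qed

text \<open>Since the number of roots is at most the degree, attaining it leaves no room for an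
  irreducible quadratic factor. The roots are indexed by \<open>{..<degree p}\<close>, and \<open>l\<close> lists their
  negatives, which turn out to be positive for directions in the cone.\<close>
lemma real_rooted_poly_splits:
  fixes p :: "real poly"
  assumes "p \<noteq> 0" "size (proots p) = degree p"
  shows "\<exists>l::nat \<Rightarrow> real. \<forall>t. poly p t = lead_coeff p * (\<Prod>i<degree p. t + l i)"
  using assms
proof (induction "degree p" arbitrary: p)
  case 0
  then show ?case by (metis degree_eq_zeroE lead_coeff_pCons(2) lessThan_0 mult.right_neutral pCons_0_0 poly_0 poly_const_conv prod.empty coeff_pCons_0 degree_pCons_0)
next
  case (Suc n)
  then obtain r where "r \<in># proots p" by (metis multiset_nonemptyE size_empty nat.distinct(1))
  then have "poly p r = 0" using Suc.prems by simp
  then obtain q where p: "p = [:-r, 1:] * q" by (auto simp: poly_eq_0_iff_dvd)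
  have "q \<noteq> 0" using p Suc.prems by auto
  have deg: "degree p = Suc (degree q)"
    using \<open>q \<noteq> 0\<close> unfolding p by (subst degree_mult_eq) auto
  have "proots p = {#r#} + proots q"
    using \<open>q \<noteq> 0\<close> unfolding p by (subst proots_mult) auto
  then have "size (proots q) = degree q" using Suc.prems deg by simp
  then obtain l where l: "\<And>t. poly q t = lead_coeff q * (\<Prod>i<degree q. t + l i)"
    using Suc.hyps(1)[of q] deg Suc.hyps(2) \<open>q \<noteq> 0\<close> by auto
  have lc: "lead_coeff p = lead_coeff q" unfolding p by (subst lead_coeff_mult) simp
  show ?case
  proof (intro exI allI)
    fix t
    have "(\<Prod>i<degree q. t + (l(degree q := -r)) i) = (\<Prod>i<degree q. t + l i)"
      by (intro prod.cong) auto
    then have "(\<Prod>i<degree p. t + (l(degree q := -r)) i) = (\<Prod>i<degree q. t + l i) * (t - r)"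
      unfolding deg by simp
    moreover have "poly p t = (t - r) * (lead_coeff q * (\<Prod>i<degree q. t + l i))"
      unfolding l[symmetric] by (simp add: p algebra_simps)
    ultimately show "poly p t = lead_coeff p * (\<Prod>i<degree p. t + (l(degree q := -r)) i)"
      unfolding lc by simp
  qed
qed

text \<open>The tangent inequality \<open>ln y \<le> y - 1\<close> at each \<open>a i / m\<close>, summed over \<open>i\<close>. It is strict
  away from \<open>y = 1\<close>, so equality of the sums forces equality in every term; this equality case is
  what decides all the equality cases below.\<close>
lemma root_prod_le_mean:
  fixes a :: "nat \<Rightarrow> real"
  assumes "N \<ge> 1" and pos: "\<And>i. i < N \<Longrightarrow> a i > 0"
  defines "m \<equiv> (\<Sum>i<N. a i) / real N"
  shows "root N (\<Prod>i<N. a i) \<le> m"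
    and "root N (\<Prod>i<N. a i) = m \<Longrightarrow> i < N \<Longrightarrow> a i = m"
proof -
  have "(\<Sum>i<N. a i) > 0"
    using assms by (intro sum_pos) (auto simp: lessThan_empty_iff)
  then have m: "m > 0" using assms by simp
  have P: "(\<Prod>i<N. a i) > 0" using pos by (intro prod_pos) auto
  have tangent: "ln (a i) \<le> ln m + (a i / m - 1)" if "i < N" for i
    using ln_le_minus_one[of "a i / m"] pos[OF that] m by (simp add: ln_div)
  have total: "(\<Sum>i<N. ln m + (a i / m - 1)) = real N * ln m"
  proof -
    have "(\<Sum>i<N. a i / m) = real N"
      using m \<open>N \<ge> 1\<close> \<open>(\<Sum>i<N. a i) > 0\<close>
      by (simp add: m_def flip: sum_divide_distrib sum_distrib_right)
    then show ?thesis by (simp add: sum.distrib sum_subtractf)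
  qed
  have lnP: "ln (\<Prod>i<N. a i) = (\<Sum>i<N. ln (a i))"
  proof (intro ln_prod)
    show "a i \<noteq> 0" if "i \<in> {..<N}" for i using pos[of i] that by simp
  qed simp
  have lnroot: "ln (root N (\<Prod>i<N. a i)) = (\<Sum>i<N. ln (a i)) / real N"
    using P \<open>N \<ge> 1\<close> by (simp add: ln_root lnP)
  have rpos: "root N (\<Prod>i<N. a i) > 0" using P \<open>N \<ge> 1\<close> by simp
  have "(\<Sum>i<N. ln (a i)) \<le> real N * ln m"
    unfolding total[symmetric] by (intro sum_mono tangent) simp
  then have "ln (root N (\<Prod>i<N. a i)) \<le> ln m"
    using \<open>N \<ge> 1\<close> by (simp add: lnroot field_simps)
  then show "root N (\<Prod>i<N. a i) \<le> m" using rpos m by simp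
  assume eq: "root N (\<Prod>i<N. a i) = m" and i: "i < N"
  have "(\<Sum>i<N. ln (a i)) = (\<Sum>i<N. ln m + (a i / m - 1))"
    using lnroot \<open>N \<ge> 1\<close> unfolding total eq by (simp add: field_simps)
  then have "(\<Sum>i<N. (ln m + (a i / m - 1)) - ln (a i)) = 0"
    by (simp add: sum_subtractf)
  then have "(ln m + (a i / m - 1)) - ln (a i) = 0"
    using tangent i by (subst (asm) sum_nonneg_eq_0_iff) auto
  then have "ln (a i / m) = a i / m - 1"
    using pos[OF i] m by (simp add: ln_div)
  then have "a i / m = 1"
    using pos[OF i] m by (intro ln_eq_minus_one) auto
  then show "a i = m" using m by simp
qed

section \<open>Complexification and change of the hyperbolic direction\<close>

text \<open>Garding's condition at a single point \<open>e\<close>, with the real roots made explicit: the numbers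
  \<open>l i\<close> are the negated roots, that is, the eigenvalues of \<open>v\<close> relative to \<open>e\<close>.\<close>
definition hyperbolic :: "nat \<Rightarrow> ('a::euclidean_space \<Rightarrow> real) \<Rightarrow> 'a \<Rightarrow> bool" where
  "hyperbolic N g e \<longleftrightarrow> g e > 0 \<and>
     (\<forall>v. \<exists>l::nat \<Rightarrow> real. \<forall>t. g (t *\<^sub>R e + v) = g e * (\<Prod>i<N. t + l i))"

text \<open>An extension of \<open>(\<alpha>, \<beta>, \<gamma>) \<mapsto> g (\<alpha> *\<^sub>R x + \<beta> *\<^sub>R e + \<gamma> *\<^sub>R a)\<close> to complex coefficients.
  Instead of complexifying the vector space and introducing polynomials in several variables, the
  extension is only required to be continuous and polynomial along complex lines: that is enough to
  carry identities from real to complex coefficients one variable at a time.\<close>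
definition complex_extension ::
    "('a::euclidean_space \<Rightarrow> real) \<Rightarrow> 'a \<Rightarrow> 'a \<Rightarrow> 'a \<Rightarrow> (complex \<Rightarrow> complex \<Rightarrow> complex \<Rightarrow> complex) \<Rightarrow> bool" where
  "complex_extension g x e a h \<longleftrightarrow>
     (\<forall>\<alpha> \<beta> \<gamma>::real. h (of_real \<alpha>) (of_real \<beta>) (of_real \<gamma>) = of_real (g (\<alpha> *\<^sub>R x + \<beta> *\<^sub>R e + \<gamma> *\<^sub>R a))) \<and>
     continuous_on UNIV (\<lambda>z. h (fst z) (fst (snd z)) (snd (snd z))) \<and>
     (\<forall>\<alpha> \<beta> \<gamma> \<alpha>' \<beta>' \<gamma>'. \<exists>p. \<forall>\<zeta>. h (\<alpha> + \<zeta> * \<alpha>') (\<beta> + \<zeta> * \<beta>') (\<gamma> + \<zeta> * \<gamma>') = poly p \<zeta>)"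

lemma complex_extension_exists:
  assumes "real_polynomial_function g"
  shows "\<exists>h. complex_extension g x e a h"
  using assms
proof (induction rule: real_polynomial_function.induct)
  case (linear f)
  interpret bounded_linear f by fact
  show ?case
    unfolding complex_extension_def
  proof (intro exI conjI allI)
    let ?h = "\<lambda>\<alpha> \<beta> \<gamma>. \<alpha> * of_real (f x) + \<beta> * of_real (f e) + \<gamma> * complex_of_real (f a)"
    show "?h (of_real \<alpha>) (of_real \<beta>) (of_real \<gamma>) = of_real (f (\<alpha> *\<^sub>R x + \<beta> *\<^sub>R e + \<gamma> *\<^sub>R a))"
      for \<alpha> \<beta> \<gamma> :: real
      by (simp add: add scale)
    show "continuous_on UNIV (\<lambda>z. ?h (fst z) (fst (snd z)) (snd (snd z)))"
      by (intro continuous_intros)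
    fix \<alpha> \<beta> \<gamma> \<alpha>' \<beta>' \<gamma>' \<zeta>
    show "?h (\<alpha> + \<zeta> * \<alpha>') (\<beta> + \<zeta> * \<beta>') (\<gamma> + \<zeta> * \<gamma>') = poly [:?h \<alpha> \<beta> \<gamma>, ?h \<alpha>' \<beta>' \<gamma>':] \<zeta>"
      by (simp add: algebra_simps)
  qed
next
  case (const c)
  show ?case
    unfolding complex_extension_def
    by (intro exI[of _ "\<lambda>_ _ _. of_real c"] conjI allI exI[of _ "[:of_real c:]"]) auto
next
  case (add f g)
  then obtain h k where h: "complex_extension f x e a h" and k: "complex_extension g x e a k"
    by blast
  show ?case
    unfolding complex_extension_def
  proof (intro exI[of _ "\<lambda>\<alpha> \<beta> \<gamma>. h \<alpha> \<beta> \<gamma> + k \<alpha> \<beta> \<gamma>"] conjI allI)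
    fix \<alpha> \<beta> \<gamma> \<alpha>' \<beta>' \<gamma>'
    obtain p q where "\<forall>\<zeta>. h (\<alpha> + \<zeta> * \<alpha>') (\<beta> + \<zeta> * \<beta>') (\<gamma> + \<zeta> * \<gamma>') = poly p \<zeta>"
      "\<forall>\<zeta>. k (\<alpha> + \<zeta> * \<alpha>') (\<beta> + \<zeta> * \<beta>') (\<gamma> + \<zeta> * \<gamma>') = poly q \<zeta>"
      using h k unfolding complex_extension_def by meson
    then show "\<exists>p. \<forall>\<zeta>. h (\<alpha> + \<zeta> * \<alpha>') (\<beta> + \<zeta> * \<beta>') (\<gamma> + \<zeta> * \<gamma>')
        + k (\<alpha> + \<zeta> * \<alpha>') (\<beta> + \<zeta> * \<beta>') (\<gamma> + \<zeta> * \<gamma>') = poly p \<zeta>"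
      by (intro exI[of _ "p + q"]) simp
  qed (use h k in \<open>auto simp: complex_extension_def intro: continuous_on_add\<close>)
next
  case (mult f g)
  then obtain h k where h: "complex_extension f x e a h" and k: "complex_extension g x e a k"
    by blast
  show ?case
    unfolding complex_extension_def
  proof (intro exI[of _ "\<lambda>\<alpha> \<beta> \<gamma>. h \<alpha> \<beta> \<gamma> * k \<alpha> \<beta> \<gamma>"] conjI allI)
    fix \<alpha> \<beta> \<gamma> \<alpha>' \<beta>' \<gamma>'
    obtain p q where "\<forall>\<zeta>. h (\<alpha> + \<zeta> * \<alpha>') (\<beta> + \<zeta> * \<beta>') (\<gamma> + \<zeta> * \<gamma>') = poly p \<zeta>"
      "\<forall>\<zeta>. k (\<alpha> + \<zeta> * \<alpha>') (\<beta> + \<zeta> * \<beta>') (\<gamma> + \<zeta> * \<gamma>') = poly q \<zeta>"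
      using h k unfolding complex_extension_def by meson
    then show "\<exists>p. \<forall>\<zeta>. h (\<alpha> + \<zeta> * \<alpha>') (\<beta> + \<zeta> * \<beta>') (\<gamma> + \<zeta> * \<gamma>')
        * k (\<alpha> + \<zeta> * \<alpha>') (\<beta> + \<zeta> * \<beta>') (\<gamma> + \<zeta> * \<gamma>') = poly p \<zeta>"
      by (intro exI[of _ "p * q"]) simp
  qed (use h k in \<open>auto simp: complex_extension_def intro: continuous_on_mult\<close>)
qed

locale complexified_form =
  fixes N :: nat and g :: "'a::euclidean_space \<Rightarrow> real" and x e a :: 'a
    and h :: "complex \<Rightarrow> complex \<Rightarrow> complex \<Rightarrow> complex"
  assumes homogeneous: "\<And>c v. g (c *\<^sub>R v) = c ^ N * g v"
    and extension: "complex_extension g x e a h"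
begin

lemma of_reals: "h (of_real \<alpha>) (of_real \<beta>) (of_real \<gamma>) = of_real (g (\<alpha> *\<^sub>R x + \<beta> *\<^sub>R e + \<gamma> *\<^sub>R a))"
  using extension by (simp add: complex_extension_def)

lemma poly_on_line:
  "\<exists>p. \<forall>\<zeta>. h (\<alpha> + \<zeta> * \<alpha>') (\<beta> + \<zeta> * \<beta>') (\<gamma> + \<zeta> * \<gamma>') = poly p \<zeta>"
  using extension unfolding complex_extension_def by meson

lemma continuous_on_h [continuous_intros]:
  assumes "continuous_on S u" "continuous_on S v" "continuous_on S w"
  shows "continuous_on S (\<lambda>z. h (u z) (v z) (w z))"
proof -
  have "continuous_on UNIV (\<lambda>z. h (fst z) (fst (snd z)) (snd (snd z)))"
    using extension by (simp add: complex_extension_def)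
  from continuous_on_compose2[OF this, of S "\<lambda>z. (u z, v z, w z)"] assms
  show ?thesis by (simp add: continuous_on_Pair)
qed

text \<open>Both sides are polynomial in each of \<open>c\<close>, \<open>\<alpha>\<close>, \<open>\<beta>\<close>, \<open>\<gamma>\<close>, so the identity for real
  numbers may be freed in these variables one after the other.\<close>
lemma homogeneous_complex: "h (c * \<alpha>) (c * \<beta>) (c * \<gamma>) = c ^ N * h \<alpha> \<beta> \<gamma>"
proof -
  have reals: "h (c * of_real \<alpha>) (c * of_real \<beta>) (c * of_real \<gamma>)
      = c ^ N * h (of_real \<alpha>) (of_real \<beta>) (of_real \<gamma>)" for c and \<alpha> \<beta> \<gamma> :: real
  proof -
    obtain p where p: "\<And>\<zeta>. h (0 + \<zeta> * of_real \<alpha>) (0 + \<zeta> * of_real \<beta>) (0 + \<zeta> * of_real \<gamma>) = poly p \<zeta>"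
      using poly_on_line by blast
    let ?q = "monom (h (of_real \<alpha>) (of_real \<beta>) (of_real \<gamma>)) N"
    have "poly p (of_real t) = poly ?q (of_real t)" for t :: real
    proof -
      have "poly p (of_real t) = h (of_real (t * \<alpha>)) (of_real (t * \<beta>)) (of_real (t * \<gamma>))"
        using p[of "of_real t"] by simp
      also have "\<dots> = of_real (g (t *\<^sub>R (\<alpha> *\<^sub>R x + \<beta> *\<^sub>R e + \<gamma> *\<^sub>R a)))"
        unfolding of_reals by (simp add: algebra_simps)
      finally show ?thesis
        unfolding homogeneous by (simp add: poly_monom of_reals)
    qed
    from poly_eq_if_agree_on_reals[OF this, of c] p[of c] show ?thesis
      by (simp add: poly_monom)
  qed
  have first: "h (c * \<alpha>) (c * of_real \<beta>) (c * of_real \<gamma>) = c ^ N * h \<alpha> (of_real \<beta>) (of_real \<gamma>)"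
    for \<alpha> and \<beta> \<gamma> :: real
  proof -
    obtain p where p: "\<And>\<zeta>. h (0 + \<zeta> * c) (c * of_real \<beta> + \<zeta> * 0) (c * of_real \<gamma> + \<zeta> * 0) = poly p \<zeta>"
      using poly_on_line by blast
    obtain q where q: "\<And>\<zeta>. h (0 + \<zeta> * 1) (of_real \<beta> + \<zeta> * 0) (of_real \<gamma> + \<zeta> * 0) = poly q \<zeta>"
      using poly_on_line by blast
    have "poly p (of_real t) = poly (smult (c ^ N) q) (of_real t)" for t :: real
      using p[of "of_real t"] q[of "of_real t"] reals[of c t \<beta> \<gamma>] by (simp add: mult.commute)
    from poly_eq_if_agree_on_reals[OF this, of \<alpha>] p[of \<alpha>] q[of \<alpha>] show ?thesis
      by (simp add: mult.commute)
  qed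
  have second: "h (c * \<alpha>) (c * \<beta>) (c * of_real \<gamma>) = c ^ N * h \<alpha> \<beta> (of_real \<gamma>)"
    for \<alpha> \<beta> and \<gamma> :: real
  proof -
    obtain p where p: "\<And>\<zeta>. h (c * \<alpha> + \<zeta> * 0) (0 + \<zeta> * c) (c * of_real \<gamma> + \<zeta> * 0) = poly p \<zeta>"
      using poly_on_line by blast
    obtain q where q: "\<And>\<zeta>. h (\<alpha> + \<zeta> * 0) (0 + \<zeta> * 1) (of_real \<gamma> + \<zeta> * 0) = poly q \<zeta>"
      using poly_on_line by blast
    have "poly p (of_real t) = poly (smult (c ^ N) q) (of_real t)" for t :: real
      using p[of "of_real t"] q[of "of_real t"] first[of \<alpha> t \<gamma>] by (simp add: mult.commute)
    from poly_eq_if_agree_on_reals[OF this, of \<beta>] p[of \<beta>] q[of \<beta>] show ?thesis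
      by (simp add: mult.commute)
  qed
  obtain p where p: "\<And>\<zeta>. h (c * \<alpha> + \<zeta> * 0) (c * \<beta> + \<zeta> * 0) (0 + \<zeta> * c) = poly p \<zeta>"
    using poly_on_line by blast
  obtain q where q: "\<And>\<zeta>. h (\<alpha> + \<zeta> * 0) (\<beta> + \<zeta> * 0) (0 + \<zeta> * 1) = poly q \<zeta>"
    using poly_on_line by blast
  have "poly p (of_real t) = poly (smult (c ^ N) q) (of_real t)" for t :: real
    using p[of "of_real t"] q[of "of_real t"] second[of \<alpha> \<beta> t] by (simp add: mult.commute)
  from poly_eq_if_agree_on_reals[OF this, of \<gamma>] p[of \<gamma>] q[of \<gamma>] show ?thesis
    by (simp add: mult.commute)
qed

lemma factorization:
  assumes "g a \<noteq> 0"
  shows "\<exists>\<mu>. \<forall>t. h \<alpha> \<beta> t = of_real (g a) * (\<Prod>i<N. t + \<mu> i)"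
proof -
  obtain p where p: "\<And>\<zeta>. h (\<alpha> + \<zeta> * 0) (\<beta> + \<zeta> * 0) (0 + \<zeta> * 1) = poly p \<zeta>"
    using poly_on_line by blast
  obtain q where q: "\<And>\<zeta>. h (0 + \<zeta> * \<alpha>) (0 + \<zeta> * \<beta>) (1 + \<zeta> * 0) = poly q \<zeta>"
    using poly_on_line by blast
  have q0: "poly q 0 = of_real (g a)"
    using of_reals[of 0 0 1] by (simp flip: q)
  have rev: "poly p t = t ^ N * poly q (inverse t)" if "t \<noteq> 0" for t
    using homogeneous_complex[of t "\<alpha> / t" "\<beta> / t" 1] that
    by (simp flip: p q add: field_simps)
  have "degree p = N" "lead_coeff p = of_real (g a)"
    using degree_lead_coeff_of_reversal[OF rev] assms q0 by auto
  moreover obtain r where "smult (lead_coeff p) (\<Prod>i<degree p. [:-r i, 1:]) = p"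
    using complex_poly_decompose' by blast
  ultimately have "p = smult (of_real (g a)) (\<Prod>i<N. [:-r i, 1:])"
    by simp
  then have "poly p t = of_real (g a) * (\<Prod>i<N. t + - r i)" for t
    by (simp add: poly_prod)
  then show ?thesis
    using p by (intro exI[of _ "\<lambda>i. - r i"]) simp
qed

lemma factorization_hyperbolic:
  assumes "hyperbolic N g e"
  shows "\<exists>l::nat \<Rightarrow> real. \<forall>s. h (of_real \<alpha>) s (of_real \<gamma>) = of_real (g e) * (\<Prod>i<N. s + of_real (l i))"
proof -
  obtain l where l: "\<And>t. g (t *\<^sub>R e + (\<alpha> *\<^sub>R x + \<gamma> *\<^sub>R a)) = g e * (\<Prod>i<N. t + l i)"
    using assms unfolding hyperbolic_def by meson
  obtain p where p: "\<And>\<zeta>. h (of_real \<alpha> + \<zeta> * 0) (0 + \<zeta> * 1) (of_real \<gamma> + \<zeta> * 0) = poly p \<zeta>"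
    using poly_on_line by blast
  let ?q = "smult (of_real (g e)) (\<Prod>i<N. [:of_real (l i), 1:])"
  have q: "poly ?q s = of_real (g e) * (\<Prod>i<N. s + of_real (l i))" for s :: complex
    by (simp add: poly_prod add.commute)
  have "poly p (of_real t) = poly ?q (of_real t)" for t :: real
  proof -
    have "poly p (of_real t) = of_real (g (t *\<^sub>R e + (\<alpha> *\<^sub>R x + \<gamma> *\<^sub>R a)))"
      using p[of "of_real t"] of_reals[of \<alpha> t \<gamma>] by (simp add: algebra_simps)
    then show ?thesis unfolding q l by simp
  qed
  from poly_eq_if_agree_on_reals[OF this] p q show ?thesis
    by auto
qed

text \<open>A quantitative form of the continuity of roots. If all \<open>N\<close> roots of \<open>h \<alpha> \<beta>\<close> were at
  distance at least \<open>\<epsilon>\<close> from \<open>t0\<close>, the factorization would give \<open>\<bar>h \<alpha> \<beta> t0\<bar> \<ge> \<bar>g a\<bar> \<epsilon>\<^sup>N\<close>;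
  but this value tends to \<open>0\<close>.\<close>
lemma root_persists:
  assumes "g a \<noteq> 0" "h \<alpha>0 \<beta>0 t0 = 0" "\<epsilon> > 0"
  obtains U where "open U" "(\<alpha>0, \<beta>0) \<in> U"
    "\<And>\<alpha> \<beta>. (\<alpha>, \<beta>) \<in> U \<Longrightarrow> \<exists>t. dist t t0 < \<epsilon> \<and> h \<alpha> \<beta> t = 0"
proof
  let ?U = "{z. norm (h (fst z) (snd z) t0) < \<bar>g a\<bar> * \<epsilon> ^ N}"
  show "open ?U"
    by (intro open_Collect_less continuous_intros)
  show "(\<alpha>0, \<beta>0) \<in> ?U"
    using assms by simp
  fix \<alpha> \<beta> assume U: "(\<alpha>, \<beta>) \<in> ?U"
  obtain \<mu> where \<mu>: "\<And>t. h \<alpha> \<beta> t = of_real (g a) * (\<Prod>i<N. t + \<mu> i)"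
    using factorization[OF assms(1)] by meson
  have "\<exists>i<N. norm (t0 + \<mu> i) < \<epsilon>"
  proof (rule ccontr)
    assume "\<not> ?thesis"
    then have "(\<Prod>i<N. \<epsilon>) \<le> (\<Prod>i<N. norm (t0 + \<mu> i))"
      using assms by (intro prod_mono) force
    then have "\<bar>g a\<bar> * \<epsilon> ^ N \<le> norm (h \<alpha> \<beta> t0)"
      by (simp add: \<mu> norm_mult prod_norm mult_left_mono)
    with U show False by simp
  qed
  then obtain i where i: "i < N" "norm (t0 + \<mu> i) < \<epsilon>" by blast
  then have "dist (- \<mu> i) t0 < \<epsilon>"
    by (simp add: dist_norm norm_minus_commute add.commute flip: norm_minus_cancel[of "t0 + \<mu> i"])
  moreover have "h \<alpha> \<beta> (- \<mu> i) = 0"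
    using i(1) by (auto simp: \<mu>)
  ultimately show "\<exists>t. dist t t0 < \<epsilon> \<and> h \<alpha> \<beta> t = 0" by blast
qed

text \<open>By homogeneity a large root \<open>t\<close> would be a zero of \<open>h (\<alpha> / t) (\<beta> / t) 1\<close>, which is close to
  \<open>h 0 0 1 = g a \<noteq> 0\<close>.\<close>
lemma roots_bounded:
  assumes "g a \<noteq> 0"
  obtains R where "\<And>\<alpha> \<beta> t. norm \<alpha> \<le> 1 \<Longrightarrow> norm \<beta> \<le> 1 \<Longrightarrow> h \<alpha> \<beta> t = 0 \<Longrightarrow> norm t \<le> R"
proof -
  have "open {z. h (fst z) (snd z) 1 \<noteq> 0}"
    by (intro open_Collect_neq continuous_intros)
  moreover have "0 \<in> {z. h (fst z) (snd z) 1 \<noteq> 0}"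
    using of_reals[of 0 0 1] assms by simp
  ultimately obtain d where "d > 0" and d: "ball 0 d \<subseteq> {z. h (fst z) (snd z) 1 \<noteq> 0}"
    by (meson open_contains_ball)
  show ?thesis
  proof (rule that[of "2 / d"], rule ccontr)
    fix \<alpha> \<beta> t assume *: "norm \<alpha> \<le> 1" "norm \<beta> \<le> 1" "h \<alpha> \<beta> t = 0" "\<not> norm t \<le> 2 / d"
    then have "2 / d < norm t" by simp
    then have "t \<noteq> 0" using \<open>d > 0\<close> by (auto simp: divide_simps)
    have "norm (\<alpha> / t, \<beta> / t) \<le> norm (\<alpha> / t) + norm (\<beta> / t)"
      by (rule norm_Pair_le)
    also have "\<dots> \<le> 1 / norm t + 1 / norm t"
      using * by (intro add_mono) (auto simp: norm_divide divide_right_mono)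
    also have "\<dots> < d"
      using \<open>2 / d < norm t\<close> \<open>d > 0\<close> \<open>t \<noteq> 0\<close> by (simp add: field_simps)
    finally have "(\<alpha> / t, \<beta> / t) \<in> ball 0 d"
      by simp
    then have "h (\<alpha> / t) (\<beta> / t) 1 \<noteq> 0" using d by auto
    then show False
      using homogeneous_complex[of t "\<alpha> / t" "\<beta> / t" 1] * \<open>t \<noteq> 0\<close> by simp
  qed
qed

text \<open>The path \<open>s \<mapsto> \<sigma> s x + \<i> (1 - s) e\<close> leads from \<open>\<i> e\<close> to \<open>\<sigma> x\<close>. For \<open>s < 1\<close> the
  polynomial \<open>t \<mapsto> g (\<sigma> s x + \<i> (1 - s) e + t a)\<close> has no real root, because for real \<open>t\<close> the
  form is evaluated at a real vector plus a non-real multiple of \<open>e\<close>, and \<open>g\<close> is hyperbolic at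
  \<open>e\<close>. Roots therefore cannot cross the real axis while \<open>s\<close> runs through \<open>[0, 1)\<close>. At \<open>s = 0\<close>
  they all lie in the lower half-plane, by positivity of \<open>g\<close> on the ray from \<open>a\<close> in direction
  \<open>e\<close>; so at \<open>s = 1\<close> none has left the closed lower half-plane.\<close>
lemma no_root_in_upper_half_plane:
  assumes hyp: "hyperbolic N g e" and a: "\<And>t. t \<ge> 0 \<Longrightarrow> g (a + t *\<^sub>R e) > 0"
    and \<sigma>: "\<bar>\<sigma>\<bar> \<le> 1" and root: "h (of_real \<sigma>) 0 t = 0"
  shows "Im t \<le> 0"
proof (rule ccontr)
  assume "\<not> Im t \<le> 0"
  have ga: "g a \<noteq> 0" using a[of 0] by simp
  have ge: "g e \<noteq> 0" using hyp by (simp add: hyperbolic_def)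
  define H where "H s t = h (of_real (\<sigma> * s)) (\<i> * of_real (1 - s)) t" for s :: real and t
  define Z where "Z = {s \<in> {0..<1}. \<exists>t. Im t > 0 \<and> H s t = 0}"
  have no_real: "H s t \<noteq> 0" if "s < 1" "Im t = 0" for s t
  proof -
    from that have t: "t = of_real (Re t)" by (simp add: complex_eq_iff)
    obtain l where l: "\<And>b. h (of_real (\<sigma> * s)) b (of_real (Re t)) = of_real (g e) * (\<Prod>i<N. b + of_real (l i))"
      using factorization_hyperbolic[OF hyp] by meson
    have "\<i> * of_real (1 - s) + of_real (l i) \<noteq> 0" for i
      using that by (simp add: complex_eq_iff)
    then show ?thesis
      unfolding H_def by (subst t, subst l) (use ge in auto)
  qed
  have "0 \<notin> Z"
  proof
    assume "0 \<in> Z"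
    then obtain t where t: "Im t > 0" "h 0 \<i> t = 0" by (auto simp: Z_def H_def)
    then have "t \<noteq> 0" by auto
    obtain l where l: "\<And>b. h (of_real 0) b (of_real 1) = of_real (g e) * (\<Prod>i<N. b + of_real (l i))"
      using factorization_hyperbolic[OF hyp] by meson
    have "h 0 (\<i> / t) 1 = 0"
      using homogeneous_complex[of t 0 "\<i> / t" 1] t \<open>t \<noteq> 0\<close> by simp
    then obtain i where i: "i < N" "\<i> / t + of_real (l i) = 0"
      using l[of "\<i> / t"] ge by auto
    have "(\<i> / t + of_real (l i)) * t = 0" using i(2) by simp
    then have "\<i> + of_real (l i) * t = 0" using \<open>t \<noteq> 0\<close> by (simp add: distrib_right)
    then have "Im (\<i> + of_real (l i) * t) = 0" by simp
    then have "1 + l i * Im t = 0" by simp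
    then have "l i < 0" using t(1) by (smt (verit) mult_nonneg_nonneg)
    then have "g (a + (- l i) *\<^sub>R e) > 0" by (intro a) simp
    moreover have "complex_of_real (g (a + (- l i) *\<^sub>R e)) = h (of_real 0) (of_real (- l i)) (of_real 1)"
      unfolding of_reals by (simp add: add.commute)
    moreover have "h (of_real 0) (of_real (- l i)) (of_real 1) = 0"
      unfolding l using i(1) by auto
    ultimately show False by simp
  qed
  moreover have "openin (top_of_set {0..<1}) Z"
  proof (rule openin_subopen[THEN iffD2], rule ballI)
    fix s0 assume "s0 \<in> Z"
    then obtain t0 where t0: "s0 \<in> {0..<1}" "Im t0 > 0" "H s0 t0 = 0"
      unfolding Z_def by blast
    obtain U where U: "open U" "(of_real (\<sigma> * s0), \<i> * of_real (1 - s0)) \<in> U"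
      "\<And>\<alpha> \<beta>. (\<alpha>, \<beta>) \<in> U \<Longrightarrow> \<exists>t. dist t t0 < Im t0 \<and> h \<alpha> \<beta> t = 0"
      using root_persists[OF ga] t0 unfolding H_def by metis
    let ?T = "(\<lambda>s. (complex_of_real (\<sigma> * s), \<i> * complex_of_real (1 - s))) -` U"
    have "open ?T"
      by (intro open_vimage U continuous_intros)
    moreover have "{0..<1} \<inter> ?T \<subseteq> Z"
    proof
      fix s assume s: "s \<in> {0..<1} \<inter> ?T"
      then obtain t where t: "dist t t0 < Im t0" "H s t = 0"
        using U(3) by (auto simp: H_def)
      have "\<bar>Im t - Im t0\<bar> < Im t0"
        using t(1) abs_Im_le_cmod[of "t - t0"] by (simp add: dist_norm)
      then have "Im t > 0" by linarith
      then show "s \<in> Z" using s t(2) unfolding Z_def by blast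
    qed
    ultimately show "\<exists>T. openin (top_of_set {0..<1}) T \<and> s0 \<in> T \<and> T \<subseteq> Z"
      using U t0 by (intro exI[of _ "{0..<1} \<inter> ?T"]) (auto intro: openin_open_Int)
  qed
  moreover have "closedin (top_of_set {0..<1}) Z"
  proof -
    obtain R where R: "\<And>\<alpha> \<beta> t. norm \<alpha> \<le> 1 \<Longrightarrow> norm \<beta> \<le> 1 \<Longrightarrow> h \<alpha> \<beta> t = 0 \<Longrightarrow> norm t \<le> R"
      using roots_bounded[OF ga] by metis
    let ?K = "({0..1} \<times> cball 0 R) \<inter> ({z. H (fst z) (snd z) = 0} \<inter> {z. Im (snd z) \<ge> 0})"
    have "closed {z. H (fst z) (snd z) = 0}" "closed {z::real \<times> complex. Im (snd z) \<ge> 0}"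
      unfolding H_def by (intro closed_Collect_eq closed_Collect_le continuous_intros)+
    then have "compact ?K"
      by (intro compact_Int_closed compact_Times closed_Int) auto
    then have "closed (fst ` ?K)"
      by (intro compact_imp_closed compact_continuous_image continuous_intros)
    moreover have "Z = {0..<1} \<inter> fst ` ?K"
    proof (intro equalityI subsetI)
      fix s assume "s \<in> Z"
      then obtain t where s: "s \<in> {0..<1}" "Im t > 0" "H s t = 0" by (auto simp: Z_def)
      have "norm t \<le> R"
      proof (rule R)
        show "norm (complex_of_real (\<sigma> * s)) \<le> 1"
          using \<sigma> s mult_mono[of "\<bar>\<sigma>\<bar>" 1 "\<bar>s\<bar>" 1] by (simp add: abs_mult norm_mult)
        show "norm (\<i> * complex_of_real (1 - s)) \<le> 1"
          using s by (simp add: norm_mult del: of_real_diff)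
      qed (use s in \<open>simp add: H_def\<close>)
      then have "(s, t) \<in> ?K" using s by auto
      then show "s \<in> {0..<1} \<inter> fst ` ?K" using s by force
    next
      fix s assume "s \<in> {0..<1} \<inter> fst ` ?K"
      then obtain t where s: "s \<in> {0..<1}" "Im t \<ge> 0" "H s t = 0" by auto
      then have "Im t \<noteq> 0" using no_real by auto
      then have "Im t > 0" using s(2) by simp
      then show "s \<in> Z" using s unfolding Z_def by blast
    qed
    ultimately show ?thesis by (simp only: closedin_closed_Int)
  qed
  moreover have "connected {0..<1::real}" by simp
  ultimately have "Z = {} \<or> Z = {0..<1}"
    unfolding connected_clopen by blast
  with \<open>0 \<notin> Z\<close> have "Z = {}" by auto
  obtain U where U: "open U" "(of_real \<sigma>, 0) \<in> U"
      "\<And>\<alpha> \<beta>. (\<alpha>, \<beta>) \<in> U \<Longrightarrow> \<exists>t'. dist t' t < Im t \<and> h \<alpha> \<beta> t' = 0"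
    using root_persists[OF ga root] \<open>\<not> Im t \<le> 0\<close> by (metis not_le)
  let ?T = "(\<lambda>s. (complex_of_real (\<sigma> * s), \<i> * complex_of_real (1 - s))) -` U"
  have "open ?T"
    by (intro open_vimage U continuous_intros)
  moreover have "1 \<in> ?T" using U by simp
  ultimately obtain d where d: "d > 0" "ball 1 d \<subseteq> ?T" by (meson open_contains_ball)
  define s where "s = max 0 (1 - d / 2)"
  have "s \<in> {0..<1}" "s \<in> ball 1 d" using d(1) by (auto simp: s_def dist_real_def)
  then have "s \<in> ?T" using d(2) by blast
  then have "(complex_of_real (\<sigma> * s), \<i> * complex_of_real (1 - s)) \<in> U" by (simp only: vimage_eq)
  then obtain t' where t': "dist t' t < Im t" "H s t' = 0"
    using U(3) unfolding H_def by blast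
  have "\<bar>Im t' - Im t\<bar> < Im t"
    using t'(1) abs_Im_le_cmod[of "t' - t"] by (simp add: dist_norm)
  then have "Im t' > 0" by linarith
  then have "s \<in> Z" using t'(2) \<open>s \<in> {0..<1}\<close> unfolding Z_def by blast
  with \<open>Z = {}\<close> show False by simp
qed

end

text \<open>Using the previous lemma with \<open>\<sigma> = 1\<close> and \<open>\<sigma> = -1\<close> replaces an appeal to complex
  conjugation: by homogeneity a root \<open>t\<close> for \<open>x\<close> is a root \<open>-t\<close> for \<open>-x\<close>, so no root may lie
  above or below the real axis.\<close>
lemma hyperbolic_in_cone:
  fixes g :: "'a::euclidean_space \<Rightarrow> real"
  assumes "real_polynomial_function g" and hom: "\<And>c v. g (c *\<^sub>R v) = c ^ N * g v"
    and hyp: "hyperbolic N g e" and a: "\<And>t. t \<ge> 0 \<Longrightarrow> g (a + t *\<^sub>R e) > 0"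
  shows "hyperbolic N g a"
  unfolding hyperbolic_def
proof (intro conjI allI)
  show ga: "g a > 0" using a[of 0] by simp
  fix x
  obtain h where "complex_extension g x e a h"
    using complex_extension_exists assms(1) by blast
  then interpret complexified_form N g x e a h
    using hom by unfold_locales
  obtain \<mu> where \<mu>: "\<And>t. h 1 0 t = of_real (g a) * (\<Prod>i<N. t + \<mu> i)"
    using factorization ga by (metis less_irrefl)
  have real: "Im (\<mu> i) = 0" if "i < N" for i
  proof -
    have root: "h 1 0 (- \<mu> i) = 0" using that by (auto simp: \<mu>)
    then have "h (of_real (-1)) 0 (\<mu> i) = 0"
      using homogeneous_complex[of "-1" 1 0 "- \<mu> i"] by simp
    then have "Im (\<mu> i) \<le> 0"
      using no_root_in_upper_half_plane[OF hyp a, of "-1" "\<mu> i"] by simp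
    moreover have "Im (- \<mu> i) \<le> 0"
      using root no_root_in_upper_half_plane[OF hyp a, of 1 "- \<mu> i"] by simp
    ultimately show ?thesis by simp
  qed
  show "\<exists>l::nat \<Rightarrow> real. \<forall>t. g (t *\<^sub>R a + x) = g a * (\<Prod>i<N. t + l i)"
  proof (intro exI allI)
    fix t
    have "of_real (g (t *\<^sub>R a + x)) = h (of_real 1) (of_real 0) (of_real t)"
      unfolding of_reals by (simp add: add.commute)
    also have "\<dots> = of_real (g a) * (\<Prod>i<N. of_real t + \<mu> i)" by (simp add: \<mu>)
    also have "(\<Prod>i<N. of_real t + \<mu> i) = (\<Prod>i<N. of_real (t + Re (\<mu> i)))"
      using real by (intro prod.cong) (auto simp: complex_eq_iff)
    also have "of_real (g a) * \<dots> = complex_of_real (g a * (\<Prod>i<N. t + Re (\<mu> i)))" by simp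
    finally show "g (t *\<^sub>R a + x) = g a * (\<Prod>i<N. t + Re (\<mu> i))"
      by (simp only: of_real_eq_iff)
  qed
qed

section \<open>The Garding cone and its edge\<close>

lemma continuous_on_real_polynomial_function:
  "real_polynomial_function (g::'a::euclidean_space \<Rightarrow> real) \<Longrightarrow> continuous_on S g"
  by (simp add: differentiable_imp_continuous_on differentiable_on_real_polynomial_function)

text \<open>The set \<open>C\<close> on the right is star-shaped about \<open>e\<close>, hence connected, hence inside the
  component. It is open because a positive function on a compact segment stays positive under small
  motions of the endpoint. It is relatively closed because for \<open>v \<in> C\<close> all \<open>l i\<close> are
  positive, so \<open>g\<close> increases along the ray; the closed condition
  \<open>g v \<le> g (v + t *\<^sub>R e)\<close> together with \<open>g v > 0\<close> then puts limits back into \<open>C\<close>.\<close>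
lemma component_eq_rays:
  fixes g :: "'a::euclidean_space \<Rightarrow> real"
  assumes poly: "real_polynomial_function g" and hom: "\<And>c v. g (c *\<^sub>R v) = c ^ N * g v"
    and hyp: "hyperbolic N g e" and comp: "\<Gamma> \<in> components {x. g x > 0}" and e: "e \<in> \<Gamma>"
  shows "\<Gamma> = {v. \<forall>t\<ge>0. g (v + t *\<^sub>R e) > 0}"
proof -
  define C where "C = {v. \<forall>t\<ge>0. g (v + t *\<^sub>R e) > 0}"
  note cont [continuous_intros] = continuous_on_compose2[OF continuous_on_real_polynomial_function[OF poly, of UNIV], OF _ subset_UNIV]
  have ge: "g e > 0" using hyp by (simp add: hyperbolic_def)
  \<comment> \<open>Rescaling turns the ray into a compact segment.\<close>
  have C_segment: "C = {v. \<forall>s\<in>{0..1}. g ((1 - s) *\<^sub>R v + s *\<^sub>R e) > 0}"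
  proof (intro equalityI subsetI CollectI ballI)
    fix v s assume v: "v \<in> C" and s: "s \<in> {0..1::real}"
    show "g ((1 - s) *\<^sub>R v + s *\<^sub>R e) > 0"
    proof (cases "s = 1")
      case False
      then have "(1 - s) *\<^sub>R v + s *\<^sub>R e = (1 - s) *\<^sub>R (v + (s / (1 - s)) *\<^sub>R e)"
        using s by (simp add: scaleR_add_right)
      moreover have "g (v + (s / (1 - s)) *\<^sub>R e) > 0"
        using v s by (auto simp: C_def)
      ultimately show ?thesis
        using s False by (simp add: hom)
    qed (use ge in simp)
  next
    fix v assume v: "v \<in> {v. \<forall>s\<in>{0..1}. g ((1 - s) *\<^sub>R v + s *\<^sub>R e) > 0}"
    show "v \<in> C"
      unfolding C_def
    proof (intro CollectI allI impI)
      fix t :: real assume t: "t \<ge> 0"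
      have "(1 - t / (1 + t)) *\<^sub>R v + (t / (1 + t)) *\<^sub>R e = (1 / (1 + t)) *\<^sub>R (v + t *\<^sub>R e)"
        using t by (simp add: algebra_simps divide_simps flip: scaleR_add_left)
      moreover have "g ((1 - t / (1 + t)) *\<^sub>R v + (t / (1 + t)) *\<^sub>R e) > 0"
        using v t by auto
      ultimately have "(1 / (1 + t)) ^ N * g (v + t *\<^sub>R e) > 0" by (simp only: hom)
      then show "g (v + t *\<^sub>R e) > 0"
        using t by (simp add: zero_less_mult_iff zero_less_divide_iff)
    qed
  qed
  have "C \<subseteq> \<Gamma>"
  proof
    fix v assume v: "v \<in> C"
    have "closed_segment v e \<subseteq> {x. g x > 0}"
      using v unfolding C_segment closed_segment_def by auto
    then have "closed_segment v e \<subseteq> \<Gamma>"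
      using e by (intro components_maximal[OF comp]) auto
    then show "v \<in> \<Gamma>" by auto
  qed
  have "e \<in> C"
  proof -
    have "e + t *\<^sub>R e = (1 + t) *\<^sub>R e" for t by (simp add: algebra_simps)
    then show ?thesis using ge by (simp add: C_def hom)
  qed
  have "open C"
  proof (subst open_subopen, intro ballI)
    fix v assume v: "v \<in> C"
    let ?W = "{z::'a \<times> real. g ((1 - snd z) *\<^sub>R fst z + snd z *\<^sub>R e) > 0}"
    have "open ?W"
      by (intro open_Collect_less continuous_intros)
    moreover have "{v} \<times> {0..1} \<subseteq> ?W"
      using v by (auto simp: C_segment)
    ultimately obtain X where "v \<in> X" "open X" "X \<times> {0..1} \<subseteq> ?W"
      using Elementary_Topology.tube_lemma[of "{0..1::real}" ?W v] by auto
    then show "\<exists>T. open T \<and> v \<in> T \<and> T \<subseteq> C"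
      by (intro exI[of _ X]) (auto simp: C_segment)
  qed
  \<comment> \<open>Each condition is closed, unlike the strict ones that define \<open>C\<close>, and holds on all of \<open>C\<close>.\<close>
  define D where "D = (\<Inter>t\<in>{0..}. {v. g v \<le> g (v + t *\<^sub>R e)})"
  have "closed D"
    unfolding D_def by (intro closed_INT ballI closed_Collect_le continuous_intros)
  have "C \<subseteq> D"
  proof
    fix v assume v: "v \<in> C"
    obtain l where l: "\<And>t. g (t *\<^sub>R e + v) = g e * (\<Prod>i<N. t + l i)"
      using hyp unfolding hyperbolic_def by meson
    have "l i > 0" if "i < N" for i
    proof (rule ccontr)
      assume "\<not> l i > 0"
      then have "- l i \<ge> 0" by simp
      then have "g (v + (- l i) *\<^sub>R e) > 0" using v unfolding C_def by blast
      moreover have "g ((- l i) *\<^sub>R e + v) = 0" unfolding l using that by auto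
      ultimately show False by (simp add: add.commute)
    qed
    then have "(\<Prod>i<N. 0 + l i) \<le> (\<Prod>i<N. t + l i)" if "t \<ge> 0" for t
      using that by (intro prod_mono) (auto simp: less_imp_le)
    then have "g (0 *\<^sub>R e + v) \<le> g (t *\<^sub>R e + v)" if "t \<ge> 0" for t
      unfolding l using ge that by (intro mult_left_mono) auto
    then show "v \<in> D" by (auto simp: D_def add.commute)
  qed
  moreover have "\<Gamma> \<inter> D \<subseteq> C"
  proof
    fix v assume v: "v \<in> \<Gamma> \<inter> D"
    then have "g v > 0" using in_components_subset[OF comp] by blast
    then have "g (v + t *\<^sub>R e) > 0" if "t \<ge> 0" for t
      using v that by (auto simp: D_def intro: less_le_trans)
    then show "v \<in> C" by (simp add: C_def)
  qed
  ultimately have "C = \<Gamma> \<inter> D" using \<open>C \<subseteq> \<Gamma>\<close> by auto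
  have "openin (top_of_set \<Gamma>) C"
    using \<open>open C\<close> \<open>C \<subseteq> \<Gamma>\<close> by (simp add: open_subset)
  moreover have "closedin (top_of_set \<Gamma>) C"
    using \<open>closed D\<close> \<open>C = \<Gamma> \<inter> D\<close> by (simp only: closedin_closed_Int)
  ultimately have "C = \<Gamma>"
    using in_components_connected[OF comp] \<open>e \<in> C\<close> unfolding connected_clopen by blast
  then show ?thesis by (simp add: C_def)
qed

text \<open>The condition at one point \<open>e\<close> is replaced by the same condition at all points of the
  cone, so that every point may serve as the base point in later arguments.\<close>
locale garding_cone =
  fixes N :: nat and g :: "'a::euclidean_space \<Rightarrow> real" and \<Gamma> :: "'a set"
  assumes N: "N \<ge> 1"
    and poly: "real_polynomial_function g"
    and hom: "\<And>c v. g (c *\<^sub>R v) = c ^ N * g v"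
    and component: "\<Gamma> \<in> components {x. g x > 0}"
    and hyp: "\<And>a. a \<in> \<Gamma> \<Longrightarrow> hyperbolic N g a"

lemma garding_polynomial_imp_garding_cone:
  assumes "N \<ge> 1" "garding_polynomial N g \<Gamma>"
  shows "garding_cone N g \<Gamma>"
proof
  show hom: "g (c *\<^sub>R v) = c ^ N * g v" for c v
    using assms by (auto simp: garding_polynomial_def homogeneous_polynomial_def)
  show poly: "real_polynomial_function g" and comp: "\<Gamma> \<in> components {x. g x > 0}"
    using assms by (auto simp: garding_polynomial_def homogeneous_polynomial_def)
  obtain e where e: "e \<in> \<Gamma>"
    and roots: "\<And>v. \<exists>p::real poly. (\<forall>t. poly p t = g (t *\<^sub>R e + v)) \<and> p \<noteq> 0 \<and> size (proots p) = N"
    using assms unfolding garding_polynomial_def by blast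
  have ge: "g e > 0" using e in_components_subset[OF comp] by auto
  have "hyperbolic N g e"
    unfolding hyperbolic_def
  proof (intro conjI allI ge)
    fix v
    obtain p where p': "\<forall>t. poly p t = g (t *\<^sub>R e + v)" "p \<noteq> 0" "size (proots p) = N"
      using roots[of v] by blast
    note p = p'(1)[rule_format] p'(2,3)
    obtain q where q: "\<And>s. poly q s = g (e + s *\<^sub>R v)"
    proof -
      have "polynomial_function (\<lambda>s. e + s *\<^sub>R v)"
        by (rule polynomial_function_add[OF polynomial_function_const
            polynomial_function_bounded_linear[OF bounded_linear_scaleR_left]])
      from real_polynomial_function_compose[OF this poly]
      obtain c n where "(g \<circ> (\<lambda>s. e + s *\<^sub>R v)) = (\<lambda>s. \<Sum>i\<le>n. c i * s ^ i)"
        unfolding real_polynomial_function_iff_sum by blast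
      then have "poly (\<Sum>i\<le>n. monom (c i) i) s = g (e + s *\<^sub>R v)" for s
        by (simp add: poly_sum poly_monom fun_eq_iff)
      then show ?thesis using that by blast
    qed
    have "poly p t = t ^ N * poly q (inverse t)" if "t \<noteq> 0" for t
      using that hom[of t "e + inverse t *\<^sub>R v"] by (simp add: p q algebra_simps)
    note lead = degree_lead_coeff_of_reversal[OF this]
    have "poly q 0 = g e" by (simp add: q)
    with lead ge have deg: "degree p = N" and lc: "lead_coeff p = g e" by auto
    have "\<exists>l::nat \<Rightarrow> real. \<forall>t. poly p t = lead_coeff p * (\<Prod>i<degree p. t + l i)"
      using p(2,3) deg by (intro real_rooted_poly_splits) simp_all
    then show "\<exists>l::nat \<Rightarrow> real. \<forall>t. g (t *\<^sub>R e + v) = g e * (\<Prod>i<N. t + l i)"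
      unfolding lc unfolding deg p(1) .
  qed
  show "hyperbolic N g a" if "a \<in> \<Gamma>" for a
  proof (rule hyperbolic_in_cone[OF poly hom \<open>hyperbolic N g e\<close>])
    show "g (a + t *\<^sub>R e) > 0" if "t \<ge> 0" for t
      using \<open>a \<in> \<Gamma>\<close> that component_eq_rays[OF poly hom \<open>hyperbolic N g e\<close> comp e] by blast
  qed
qed (use assms in simp)

context garding_cone begin

text \<open>Membership is tested along rays in the direction of any chosen \<open>a\<close>. That all these tests
  agree is what makes the cone convex.\<close>
lemma cone_iff: "a \<in> \<Gamma> \<Longrightarrow> v \<in> \<Gamma> \<longleftrightarrow> (\<forall>t\<ge>0. g (v + t *\<^sub>R a) > 0)"
  using component_eq_rays[OF poly hom hyp component] by blast

lemma pos: "a \<in> \<Gamma> \<Longrightarrow> g a > 0"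
  using in_components_subset[OF component] by auto

lemma cone_nonempty: obtains a where "a \<in> \<Gamma>"
  using in_components_nonempty[OF component] by auto

lemma scale: "a \<in> \<Gamma> \<Longrightarrow> c > 0 \<Longrightarrow> c *\<^sub>R a \<in> \<Gamma>"
  by (subst cone_iff[of a]) (auto simp: hom pos simp flip: scaleR_add_left)

lemma add: "a \<in> \<Gamma> \<Longrightarrow> b \<in> \<Gamma> \<Longrightarrow> a + b \<in> \<Gamma>"
proof (subst cone_iff[of b], assumption, intro allI impI)
  fix t :: real assume "a \<in> \<Gamma>" "b \<in> \<Gamma>" "t \<ge> 0"
  then have "g (a + (1 + t) *\<^sub>R b) > 0" using cone_iff[of b a] by simp
  then show "g (a + b + t *\<^sub>R b) > 0" by (simp add: algebra_simps)
qed

lemma convex_cone: "convex \<Gamma>"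
proof (rule convexI)
  fix x y and u v :: real
  assume "x \<in> \<Gamma>" "y \<in> \<Gamma>" "0 \<le> u" "0 \<le> v" "u + v = 1"
  then show "u *\<^sub>R x + v *\<^sub>R y \<in> \<Gamma>"
    by (cases "u = 0"; cases "v = 0") (auto intro!: add scale)
qed

lemma open_cone: "open \<Gamma>"
proof -
  have "open {x. g x > 0}"
    by (intro open_Collect_less continuous_on_real_polynomial_function poly continuous_intros)
  then show ?thesis using component by (rule open_components)
qed

lemma add_closure:
  assumes "a \<in> \<Gamma>" "w \<in> closure \<Gamma>"
  shows "a + w \<in> \<Gamma>"
proof -
  obtain d where d: "d > 0" "ball a d \<subseteq> \<Gamma>" using open_cone assms by (meson open_contains_ball)
  obtain w' where w': "w' \<in> \<Gamma>" "dist w' w < d" using assms d by (meson closure_approachable)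
  have "a + (w - w') \<in> ball a d" using w' by (simp add: dist_norm norm_minus_commute)
  then have "a + (w - w') \<in> \<Gamma>" using d by blast
  from add[OF this w'(1)] have "(a + (w - w')) + w' \<in> \<Gamma>" .
  then show ?thesis by simp
qed

lemma in_closureI:
  assumes "\<And>d. d > 0 \<Longrightarrow> w + d *\<^sub>R a \<in> \<Gamma>"
  shows "w \<in> closure \<Gamma>"
proof (rule closure_sequential[THEN iffD2], intro exI conjI allI)
  show "w + inverse (real (Suc n)) *\<^sub>R a \<in> \<Gamma>" for n by (intro assms) simp
  have "(\<lambda>n. w + inverse (real (Suc n)) *\<^sub>R a) \<longlonglongrightarrow> w + 0 *\<^sub>R a"
    by (intro tendsto_intros LIMSEQ_inverse_real_of_nat)
  then show "(\<lambda>n. w + inverse (real (Suc n)) *\<^sub>R a) \<longlonglongrightarrow> w" by simp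
qed

lemma zero_in_closure: "0 \<in> closure \<Gamma>"
  by (rule cone_nonempty, rule in_closureI) (auto intro: scale)

lemma in_cone_if_pos:
  assumes "w \<in> closure \<Gamma>" "g w > 0"
  shows "w \<in> \<Gamma>"
proof -
  obtain a where a: "a \<in> \<Gamma>" by (rule cone_nonempty)
  have "g (w + t *\<^sub>R a) > 0" if "t \<ge> 0" for t
  proof (cases "t = 0")
    case False
    then have "t *\<^sub>R a + w \<in> \<Gamma>" using that assms a by (intro add_closure scale) auto
    then show ?thesis by (simp add: pos add.commute)
  qed (use assms in simp)
  then show ?thesis using cone_iff[OF a] by blast
qed

lemma eigenvalues_exist:
  assumes "a \<in> \<Gamma>"
  shows "\<exists>l::nat \<Rightarrow> real. \<forall>s t. g (t *\<^sub>R a + s *\<^sub>R v) = g a * (\<Prod>i<N. t + s * l i)"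
proof -
  obtain l where l: "\<And>t. g (t *\<^sub>R a + v) = g a * (\<Prod>i<N. t + l i)"
    using hyp[OF assms] unfolding hyperbolic_def by meson
  have "g (t *\<^sub>R a + s *\<^sub>R v) = g a * (\<Prod>i<N. t + s * l i)" for s t
  proof (cases "s = 0")
    case False
    then have "t *\<^sub>R a + s *\<^sub>R v = s *\<^sub>R ((t / s) *\<^sub>R a + v)" by (simp add: algebra_simps)
    then have "g (t *\<^sub>R a + s *\<^sub>R v) = g a * ((\<Prod>i<N. s) * (\<Prod>i<N. t / s + l i))"
      by (simp only: hom l) simp
    also have "\<dots> = g a * (\<Prod>i<N. t + s * l i)"
      unfolding prod.distrib[symmetric] using False by (simp add: algebra_simps)
    finally show ?thesis .
  qed (simp add: hom)
  then show ?thesis by blast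
qed

definition eigenvalues :: "'a \<Rightarrow> 'a \<Rightarrow> nat \<Rightarrow> real" where
  "eigenvalues a v = (SOME l. \<forall>s t. g (t *\<^sub>R a + s *\<^sub>R v) = g a * (\<Prod>i<N. t + s * l i))"

lemma eigenvalues: "a \<in> \<Gamma> \<Longrightarrow> g (t *\<^sub>R a + s *\<^sub>R v) = g a * (\<Prod>i<N. t + s * eigenvalues a v i)"
  using someI_ex[OF eigenvalues_exist] unfolding eigenvalues_def by blast

lemma eigenvalues_pos:
  assumes "a \<in> \<Gamma>" "v \<in> \<Gamma>" "i < N"
  shows "eigenvalues a v i > 0"
proof (rule ccontr)
  let ?l = "eigenvalues a v i"
  assume "\<not> ?l > 0"
  then have "- ?l \<ge> 0" by simp
  then have "g (v + (- ?l) *\<^sub>R a) > 0" using cone_iff[of a v] assms by blast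
  moreover have "g ((- ?l) *\<^sub>R a + 1 *\<^sub>R v) = 0"
    unfolding eigenvalues[OF assms(1)] using assms(3) by auto
  ultimately show False by (simp add: add.commute)
qed

lemma edge_iff: "v \<in> edge \<Gamma> \<longleftrightarrow> v \<in> closure \<Gamma> \<and> - v \<in> closure \<Gamma>"
  by (auto simp: edge_def image_iff) (metis minus_minus)

lemma roots_nonneg_closure:
  assumes a: "a \<in> \<Gamma>" and v: "v \<in> closure \<Gamma>" and "i < N"
    and l: "\<And>t. g (t *\<^sub>R a + v) = g a * (\<Prod>i<N. t + l i)"
  shows "l i \<ge> 0"
proof (rule ccontr)
  assume "\<not> l i \<ge> 0"
  then have "(- l i) *\<^sub>R a + v \<in> \<Gamma>" using a v by (intro add_closure scale) auto
  then have "g ((- l i) *\<^sub>R a + v) > 0" by (rule pos)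
  moreover have "g ((- l i) *\<^sub>R a + v) = 0" unfolding l using \<open>i < N\<close> by auto
  ultimately show False by simp
qed

lemma eigenvalues_nonneg:
  assumes "a \<in> \<Gamma>" "v \<in> closure \<Gamma>" "i < N"
  shows "eigenvalues a v i \<ge> 0"
  using roots_nonneg_closure[OF assms, of "eigenvalues a v"] eigenvalues[OF assms(1), of _ 1 v] by simp

text \<open>Vanishing of all eigenvalues relative to a single \<open>a\<close> already places \<open>v\<close> in the edge:
  \<open>s *\<^sub>R v + d *\<^sub>R a\<close> passes the ray test of \<open>a\<close> for every real \<open>s\<close> and every \<open>d > 0\<close>.\<close>
lemma in_edgeI:
  assumes a: "a \<in> \<Gamma>" and *: "\<And>s t. g (t *\<^sub>R a + s *\<^sub>R v) = t ^ N * g a"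
  shows "v \<in> edge \<Gamma>"
proof -
  have "s *\<^sub>R v \<in> closure \<Gamma>" for s
  proof (rule in_closureI)
    fix d :: real assume "d > 0"
    have "s *\<^sub>R v + d *\<^sub>R a + t *\<^sub>R a = (d + t) *\<^sub>R a + s *\<^sub>R v" for t
      by (simp add: algebra_simps)
    then have "g (s *\<^sub>R v + d *\<^sub>R a + t *\<^sub>R a) = (d + t) ^ N * g a" for t
      by (simp only: *)
    then show "s *\<^sub>R v + d *\<^sub>R a \<in> \<Gamma>"
      unfolding cone_iff[OF a] using \<open>d > 0\<close> by (simp add: pos a)
  qed
  from this[of 1] this[of "-1"] show ?thesis by (simp add: edge_iff)
qed

text \<open>Points of the closure have nonnegative eigenvalues, and those of \<open>-v\<close> are the negatives of
  those of \<open>v\<close>; so the eigenvalues of a point of the edge vanish.\<close>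
lemma edge_invariant:
  assumes a: "a \<in> \<Gamma>" and v: "v \<in> edge \<Gamma>"
  shows "a + v \<in> \<Gamma>" "g (a + v) = g a"
proof -
  have "eigenvalues a v i = 0" if "i < N" for i
  proof -
    have "g (t *\<^sub>R a + - v) = g a * (\<Prod>i<N. t + - eigenvalues a v i)" for t
      using eigenvalues[OF a, of t "-1" v] by simp
    then have "- eigenvalues a v i \<ge> 0"
      using v by (intro roots_nonneg_closure[OF a _ that, of "- v" "\<lambda>i. - eigenvalues a v i"]) (auto simp: edge_iff)
    moreover have "eigenvalues a v i \<ge> 0"
      using v a that by (intro eigenvalues_nonneg) (auto simp: edge_iff)
    ultimately show ?thesis by simp
  qed
  then have "g (1 *\<^sub>R a + 1 *\<^sub>R v) = g a"
    unfolding eigenvalues[OF a] by simp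
  then show "g (a + v) = g a" by simp
  show "a + v \<in> \<Gamma>" using assms by (intro add_closure) (auto simp: edge_iff)
qed

end

section \<open>The gradient of the logarithm\<close>

lemma gradient_eqI:
  assumes "GDERIV f x :> D"
  shows "gradient f x = D"
  unfolding gradient_def
proof (rule the_equality)
  show "GDERIV f x :> D" by fact
  fix D' assume "GDERIV f x :> D'"
  from has_derivative_unique[OF this[unfolded gderiv_def] assms[unfolded gderiv_def]]
  have "\<forall>h. h \<bullet> D' = h \<bullet> D" by (rule fun_cong[THEN allI])
  then show "D' = D" by (simp only: vector_eq_ldot)
qed

lemma GDERIV_exists:
  fixes f :: "'a::euclidean_space \<Rightarrow> real"
  assumes "f differentiable (at x)"
  obtains D where "GDERIV f x :> D"
proof -
  obtain f' where f': "(f has_derivative f') (at x)"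
    using assms by (auto simp: differentiable_def)
  then have "linear f'" by (rule has_derivative_linear)
  then have "f' = (\<lambda>h. h \<bullet> adjoint f' 1)"
    by (simp add: adjoint_works)
  with f' that show ?thesis by (metis gderiv_def)
qed

lemma GDERIV_line:
  assumes "GDERIV f x :> D"
  shows "((\<lambda>s. f (x + s *\<^sub>R v)) has_real_derivative v \<bullet> D) (at 0)"
proof -
  have "((\<lambda>s::real. x + s *\<^sub>R v) has_derivative (\<lambda>s. s *\<^sub>R v)) (at 0)"
    by (auto intro!: derivative_eq_intros)
  moreover have "(f has_derivative (\<lambda>h. h \<bullet> D)) (at (x + 0 *\<^sub>R v))"
    using assms by (simp add: gderiv_def)
  ultimately have "((\<lambda>s. f (x + s *\<^sub>R v)) has_derivative (\<lambda>s. (s *\<^sub>R v) \<bullet> D)) (at 0)"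
    by (rule has_derivative_compose)
  moreover have "(\<lambda>s::real. (s *\<^sub>R v) \<bullet> D) = (*) (v \<bullet> D)" by (auto simp: fun_eq_iff)
  ultimately show ?thesis by (simp add: has_field_derivative_def)
qed

context garding_cone begin

definition grad_log :: "'a \<Rightarrow> 'a" where "grad_log a = gradient (\<lambda>z. ln (g z)) a"

lemma GDERIV_g: obtains D where "GDERIV g a :> D"
  using GDERIV_exists differentiable_at_real_polynomial_function[OF poly] by blast

lemma GDERIV_grad_log:
  assumes "a \<in> \<Gamma>"
  shows "GDERIV (\<lambda>z. ln (g z)) a :> grad_log a"
proof -
  obtain D where "GDERIV g a :> D" by (rule GDERIV_g)
  then have "GDERIV (\<lambda>z. ln (g z)) a :> inverse (g a) *\<^sub>R D"
    using pos[OF assms] by (intro GDERIV_DERIV_compose DERIV_ln) auto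
  then show ?thesis unfolding grad_log_def using gradient_eqI by metis
qed

text \<open>The logarithmic derivative of a product of linear factors. Allowing any factorization
  \<open>l\<close> avoids having to identify it with the chosen list of eigenvalues.\<close>
lemma inner_grad_log_eq_sum:
  assumes a: "a \<in> \<Gamma>" and l: "\<And>s. g (a + s *\<^sub>R v) = g a * (\<Prod>i<N. 1 + s * l i)"
  shows "v \<bullet> grad_log a = (\<Sum>i<N. l i)"
proof -
  have "((\<lambda>s. \<Prod>i<N. 1 + s * l i) has_real_derivative
      (\<Sum>i<N. l i * (\<Prod>j\<in>{..<N} - {i}. 1 + 0 * l j))) (at 0)"
    by (rule has_field_derivative_prod) (auto intro!: derivative_eq_intros)
  then have "((\<lambda>s. \<Prod>i<N. 1 + s * l i) has_real_derivative (\<Sum>i<N. l i)) (at 0)"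
    by simp
  then have "((\<lambda>s. g a * (\<Prod>i<N. 1 + s * l i)) has_real_derivative g a * (\<Sum>i<N. l i)) (at 0)"
    by (rule DERIV_cmult)
  then have 1: "((\<lambda>s. g (a + s *\<^sub>R v)) has_real_derivative g a * (\<Sum>i<N. l i)) (at 0)"
    unfolding l .
  have "((\<lambda>s. ln (g (a + s *\<^sub>R v))) has_real_derivative
      (1 / g (a + 0 *\<^sub>R v)) * (g a * (\<Sum>i<N. l i))) (at 0)"
    by (rule DERIV_chain2[OF DERIV_ln_divide 1]) (use pos[OF a] in simp)
  then have "((\<lambda>s. ln (g (a + s *\<^sub>R v))) has_real_derivative (\<Sum>i<N. l i)) (at 0)"
    using pos[OF a] by simp
  from DERIV_unique[OF this GDERIV_line[OF GDERIV_grad_log[OF a]]] show ?thesis by simp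
qed

lemma inner_grad_log: "a \<in> \<Gamma> \<Longrightarrow> v \<bullet> grad_log a = (\<Sum>i<N. eigenvalues a v i)"
  by (rule inner_grad_log_eq_sum) (auto simp: eigenvalues[of a 1 _ v, simplified])

lemma inner_grad_log_self: "a \<in> \<Gamma> \<Longrightarrow> a \<bullet> grad_log a = real N"
proof -
  assume a: "a \<in> \<Gamma>"
  have "a + s *\<^sub>R a = (1 + s) *\<^sub>R a" for s by (simp add: algebra_simps)
  then have "a \<bullet> grad_log a = (\<Sum>i<N. 1)"
    by (intro inner_grad_log_eq_sum[OF a]) (simp add: hom)
  then show ?thesis by simp
qed

lemma grad_log_scale:
  assumes a: "a \<in> \<Gamma>" and c: "c > 0"
  shows "grad_log (c *\<^sub>R a) = (1 / c) *\<^sub>R grad_log a"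
proof -
  have "v \<bullet> grad_log (c *\<^sub>R a) = v \<bullet> ((1 / c) *\<^sub>R grad_log a)" for v
  proof -
    have "g (c *\<^sub>R a + s *\<^sub>R v) = g (c *\<^sub>R a) * (\<Prod>i<N. 1 + s * (eigenvalues a v i / c))" for s
    proof -
      have "g (c *\<^sub>R a + s *\<^sub>R v) = g a * (\<Prod>i<N. c * (1 + s * (eigenvalues a v i / c)))"
        using c by (simp add: eigenvalues[OF a] algebra_simps)
      then show ?thesis by (simp add: prod.distrib hom)
    qed
    from inner_grad_log_eq_sum[OF scale[OF a c] this]
    have "v \<bullet> grad_log (c *\<^sub>R a) = (\<Sum>i<N. eigenvalues a v i / c)" .
    then show ?thesis
      by (simp add: inner_grad_log[OF a] sum_divide_distrib)
  qed
  then have "\<forall>v. v \<bullet> grad_log (c *\<^sub>R a) = v \<bullet> ((1 / c) *\<^sub>R grad_log a)" by (rule allI)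
  then show ?thesis by (simp only: vector_eq_ldot)
qed

lemma grad_log_edge:
  assumes a: "a \<in> \<Gamma>" and v: "v \<in> edge \<Gamma>"
  shows "grad_log (a + v) = grad_log a"
proof -
  have "((\<lambda>z. z + v) has_derivative (\<lambda>h. h)) (at a)"
    by (auto intro!: derivative_eq_intros)
  from has_derivative_compose[OF this, of "\<lambda>z. ln (g z)"]
  have "GDERIV (\<lambda>z. ln (g (z + v))) a :> grad_log (a + v)"
    using GDERIV_grad_log[OF edge_invariant(1)[OF a v]] unfolding gderiv_def by blast
  then have "GDERIV (\<lambda>z. ln (g z)) a :> grad_log (a + v)"
    unfolding gderiv_def
    by (rule has_derivative_transform_within_open[OF _ open_cone a]) (simp add: edge_invariant v)
  then show ?thesis unfolding grad_log_def[of a] by (simp add: gradient_eqI)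
qed

lemma inner_grad_log_nonneg: "a \<in> \<Gamma> \<Longrightarrow> v \<in> closure \<Gamma> \<Longrightarrow> v \<bullet> grad_log a \<ge> 0"
  unfolding inner_grad_log by (intro sum_nonneg eigenvalues_nonneg) auto

lemma inner_grad_log_eq_0_imp_edge:
  assumes a: "a \<in> \<Gamma>" and v: "v \<in> closure \<Gamma>" and "v \<bullet> grad_log a = 0"
  shows "v \<in> edge \<Gamma>"
proof -
  have "\<forall>i<N. eigenvalues a v i = 0"
    using assms(3) eigenvalues_nonneg[OF a v] unfolding inner_grad_log[OF a]
    by (subst (asm) sum_nonneg_eq_0_iff) auto
  then show ?thesis
    by (intro in_edgeI[OF a]) (simp add: eigenvalues[OF a])
qed

text \<open>The heart of the matter. With \<open>l i\<close> the eigenvalues of \<open>a\<close> relative to \<open>x\<close>, the quotient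
  \<open>g a / g x\<close> is their product and \<open>a \<bullet> grad_log x\<close> is their sum, so the inequality between
  geometric and arithmetic mean is the claim. In case of equality all \<open>l i\<close> agree with their mean
  \<open>m\<close>; then \<open>a - m *\<^sub>R x\<close> has only zero eigenvalues and lies in the edge, whence \<open>a\<close> and
  \<open>m *\<^sub>R x\<close> have the same gradient.\<close>
lemma root_le_inner_grad_log:
  assumes a: "a \<in> \<Gamma>" and x: "x \<in> \<Gamma>"
  shows "root N (g a) \<le> root N (g x) * (a \<bullet> grad_log x / real N)" (is "_ \<le> _ * ?m")
    and "root N (g a) = root N (g x) * (a \<bullet> grad_log x / real N) \<Longrightarrow> grad_log x = (a \<bullet> grad_log x / real N) *\<^sub>R grad_log a"
proof -
  let ?l = "eigenvalues x a"
  have m: "?m = (\<Sum>i<N. ?l i) / real N" by (simp add: inner_grad_log[OF x])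
  have ga: "g a = g x * (\<Prod>i<N. ?l i)"
    using eigenvalues[OF x, of 0 1 a] by simp
  have root: "root N (g a) = root N (g x) * root N (\<Prod>i<N. ?l i)"
    by (simp add: ga real_root_mult)
  have gx: "root N (g x) > 0" using pos[OF x] N by simp
  have l_pos: "?l i > 0" if "i < N" for i
    using that by (rule eigenvalues_pos[OF x a])
  have "root N (\<Prod>i<N. ?l i) \<le> ?m"
    unfolding m by (rule root_prod_le_mean(1)[OF N l_pos])
  then show "root N (g a) \<le> root N (g x) * ?m"
    unfolding root using gx by (intro mult_left_mono) auto
  assume "root N (g a) = root N (g x) * ?m"
  then have "root N (g x) * root N (\<Prod>i<N. ?l i) = root N (g x) * ?m" unfolding root .
  then have "root N (\<Prod>i<N. ?l i) = ?m" using gx unfolding mult_cancel_left by simp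
  then have l: "?l i = ?m" if "i < N" for i
    using root_prod_le_mean(2)[OF N, of ?l i] l_pos that unfolding m by blast
  have "?m > 0" using l[of 0] eigenvalues_pos[OF x a, of 0] N by simp
  have "a - ?m *\<^sub>R x \<in> edge \<Gamma>"
  proof (rule in_edgeI[OF x])
    fix s t
    have "t *\<^sub>R x + s *\<^sub>R (a - ?m *\<^sub>R x) = (t - s * ?m) *\<^sub>R x + s *\<^sub>R a"
      by (simp add: algebra_simps)
    then have "g (t *\<^sub>R x + s *\<^sub>R (a - ?m *\<^sub>R x)) = g x * (\<Prod>i<N. (t - s * ?m) + s * ?l i)"
      by (simp only: eigenvalues[OF x])
    also have "(\<Prod>i<N. (t - s * ?m) + s * ?l i) = (\<Prod>i<N. t)"
      by (intro prod.cong) (auto simp: l)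
    finally show "g (t *\<^sub>R x + s *\<^sub>R (a - ?m *\<^sub>R x)) = t ^ N * g x" by simp
  qed
  from grad_log_edge[OF scale[OF x \<open>?m > 0\<close>] this] have "grad_log a = (1 / ?m) *\<^sub>R grad_log x"
    by (simp add: grad_log_scale[OF x \<open>?m > 0\<close>])
  then have "?m *\<^sub>R grad_log a = (?m * (1 / ?m)) *\<^sub>R grad_log x" by (simp only: scaleR_scaleR)
  moreover have "m * (1 / m) = 1" if "m > 0" for m :: real using that by simp
  from this[OF \<open>?m > 0\<close>] have "?m * (1 / ?m) = 1" .
  ultimately show "grad_log x = ?m *\<^sub>R grad_log a" by simp
qed

text \<open>The value is independent of the chosen preimage: if \<open>z\<close> and \<open>x\<close> have the same gradient,
  the preceding inequality applied in both orders gives \<open>g z = g x\<close>, since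
  \<open>z \<bullet> grad_log z = N\<close>.\<close>
lemma dual_garding_grad_log:
  assumes x: "x \<in> \<Gamma>"
  shows "dual_garding g \<Gamma> (grad_log x) = 1 / g x"
  unfolding dual_garding_def
proof (rule the_equality)
  show "\<exists>z\<in>\<Gamma>. gradient (\<lambda>z. ln (g z)) z = grad_log x \<and> 1 / g x = 1 / g z"
    using x by (auto simp: grad_log_def)
  fix r assume "\<exists>z\<in>\<Gamma>. gradient (\<lambda>z. ln (g z)) z = grad_log x \<and> r = 1 / g z"
  then obtain z where z: "z \<in> \<Gamma>" "grad_log z = grad_log x" "r = 1 / g z" by (auto simp: grad_log_def)
  have "root N (g z) \<le> root N (g x)"
    using root_le_inner_grad_log(1)[OF z(1) x] inner_grad_log_self[OF z(1)] z(2) N by simp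
  moreover have "root N (g x) \<le> root N (g z)"
    using root_le_inner_grad_log(1)[OF x z(1)] inner_grad_log_self[OF x] z(2) N by simp
  ultimately show "r = 1 / g x" using z(3) N by simp
qed

section \<open>The open polar is the image of the gradient map\<close>

lemma inner_polar_closure:
  assumes "y \<in> polar_cone \<Gamma>" "x \<in> closure \<Gamma>"
  shows "y \<bullet> x \<ge> 0"
proof -
  have "closed {x. y \<bullet> x \<ge> 0}" by (intro closed_Collect_le continuous_intros)
  moreover have "\<Gamma> \<subseteq> {x. y \<bullet> x \<ge> 0}" using assms(1) by (auto simp: polar_cone_def)
  ultimately show ?thesis using closure_minimal assms(2) by blast
qed

lemma inner_polar_edge: "y \<in> polar_cone \<Gamma> \<Longrightarrow> v \<in> edge \<Gamma> \<Longrightarrow> y \<bullet> v = 0"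
  using inner_polar_closure[of y v] inner_polar_closure[of y "- v"] by (simp add: edge_iff)

lemma inner_span_edge: "y \<in> span (polar_cone \<Gamma>) \<Longrightarrow> v \<in> edge \<Gamma> \<Longrightarrow> y \<bullet> v = 0"
  using orthogonal_to_span[of y "polar_cone \<Gamma>" v] inner_polar_edge
  by (auto simp: orthogonal_def inner_commute)

lemma bipolar:
  assumes "\<And>y. y \<in> polar_cone \<Gamma> \<Longrightarrow> y \<bullet> v \<ge> 0"
  shows "v \<in> closure \<Gamma>"
proof (rule ccontr)
  assume "v \<notin> closure \<Gamma>"
  from separating_hyperplane_closed_point[OF convex_closure[OF convex_cone] closed_closure this]
  obtain y b where y: "y \<bullet> v < b" "\<And>x. x \<in> closure \<Gamma> \<Longrightarrow> y \<bullet> x > b"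
    by blast
  have "b < 0" using y(2)[OF zero_in_closure] by simp
  have "y \<bullet> x \<ge> 0" if "x \<in> \<Gamma>" for x
  proof (rule ccontr)
    assume neg: "\<not> y \<bullet> x \<ge> 0"
    then have "b / (y \<bullet> x) > 0" using \<open>b < 0\<close> by (simp add: divide_neg_neg)
    then have "(b / (y \<bullet> x)) *\<^sub>R x \<in> closure \<Gamma>"
      using scale[OF that] closure_subset by blast
    from y(2)[OF this] neg show False by simp
  qed
  then have "y \<in> polar_cone \<Gamma>" by (simp add: polar_cone_def)
  from assms[OF this] y(1) \<open>b < 0\<close> show False by simp
qed

text \<open>The span of the polar is the orthogonal complement of the edge: by the bipolar argument a
  vector orthogonal to the polar lies, together with its negative, in the closed cone.\<close>
lemma split_modulo_edge:
  obtains s v where "s \<in> span (polar_cone \<Gamma>)" "v \<in> edge \<Gamma>" "x = s + v"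
proof -
  obtain s v where sv: "s \<in> span (polar_cone \<Gamma>)" "\<And>w. w \<in> span (polar_cone \<Gamma>) \<Longrightarrow> orthogonal v w" "x = s + v"
    by (rule orthogonal_subspace_decomp_exists[of "polar_cone \<Gamma>" x]) blast
  have "y \<bullet> v = 0" if "y \<in> polar_cone \<Gamma>" for y
    using sv(2)[OF span_base[OF that]] by (simp add: orthogonal_def inner_commute)
  then have "v \<in> edge \<Gamma>" unfolding edge_iff by (intro conjI bipolar) simp_all
  with sv that show ?thesis by blast
qed

lemma edge_uminus: "v \<in> edge \<Gamma> \<Longrightarrow> - v \<in> edge \<Gamma>"
  by (simp add: edge_iff)

lemma project_cone:
  assumes "x \<in> \<Gamma>"
  obtains s v where "s \<in> \<Gamma>" "s \<in> span (polar_cone \<Gamma>)" "v \<in> edge \<Gamma>" "x = s + v" "g s = g x"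
proof -
  obtain s v where sv: "s \<in> span (polar_cone \<Gamma>)" "v \<in> edge \<Gamma>" "x = s + v"
    by (rule split_modulo_edge)
  then have "s = x + - v" by simp
  then have "s \<in> \<Gamma>" "g s = g x"
    using edge_invariant[OF assms edge_uminus[OF sv(2)]] by simp_all
  with sv that show ?thesis by blast
qed

lemma open_polar_subset: "open_polar \<Gamma> \<subseteq> polar_cone \<Gamma>"
  unfolding open_polar_def by (rule interior_of_subset)

lemma grad_log_in_polar:
  assumes "a \<in> \<Gamma>"
  shows "grad_log a \<in> polar_cone \<Gamma>"
  unfolding polar_cone_def
proof (intro CollectI ballI)
  fix x assume "x \<in> \<Gamma>"
  then have "x \<in> closure \<Gamma>" by (rule subsetD[OF closure_subset])
  from inner_grad_log_nonneg[OF assms this] show "grad_log a \<bullet> x \<ge> 0" by (simp only: inner_commute)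
qed

text \<open>On the unit sphere of the span of the polar, \<open>grad_log a\<close> is positive on the closed cone,
  because a zero would lie in the edge and be orthogonal to itself. By compactness it is bounded
  below by some \<open>e > 0\<close>, and perturbing \<open>grad_log a\<close> inside the span by less than \<open>e\<close> keeps it
  in the polar.\<close>
lemma grad_log_in_open_polar:
  assumes a: "a \<in> \<Gamma>"
  shows "grad_log a \<in> open_polar \<Gamma>"
proof -
  let ?S = "span (polar_cone \<Gamma>)"
  let ?K = "(closure \<Gamma> \<inter> ?S) \<inter> sphere 0 1"
  have "compact ?K"
    by (intro closed_Int_compact closed_Int closed_closure closed_span compact_sphere)
  have Fpos: "x \<bullet> grad_log a > 0" if "x \<in> ?K" for x
  proof -
    have "x \<bullet> grad_log a \<noteq> 0"
    proof
      assume "x \<bullet> grad_log a = 0"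
      then have "x \<in> edge \<Gamma>" using inner_grad_log_eq_0_imp_edge[OF a, of x] that by auto
      then have "x \<bullet> x = 0" using that inner_span_edge[of x x] by auto
      then show False using that by simp
    qed
    then show ?thesis using inner_grad_log_nonneg[OF a, of x] that by auto
  qed
  obtain e where e: "e > 0" "\<And>x. x \<in> ?K \<Longrightarrow> e \<le> x \<bullet> grad_log a"
  proof (cases "?K = {}")
    case False
    have "continuous_on ?K (\<lambda>x. x \<bullet> grad_log a)" by (intro continuous_intros)
    from continuous_attains_inf[OF \<open>compact ?K\<close> False this]
    obtain x0 where "x0 \<in> ?K" "\<And>x. x \<in> ?K \<Longrightarrow> x0 \<bullet> grad_log a \<le> x \<bullet> grad_log a"
      by blast
    then show ?thesis using that Fpos by blast
  qed (use that[of 1] in auto)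
  have "z \<in> polar_cone \<Gamma>" if z: "z \<in> ?S" "z \<in> ball (grad_log a) e" for z
    unfolding polar_cone_def
  proof (intro CollectI ballI)
    fix x assume "x \<in> \<Gamma>"
    then obtain s v where s: "s \<in> \<Gamma>" "s \<in> ?S" "v \<in> edge \<Gamma>" "x = s + v"
      by (rule project_cone)
    have zx: "z \<bullet> x = z \<bullet> s" using inner_span_edge[OF z(1) s(3)] s(4) by (simp add: inner_add_right)
    show "z \<bullet> x \<ge> 0"
    proof (cases "s = 0")
      case False
      have "(1 / norm s) *\<^sub>R s \<in> ?K"
        using False s scale[OF s(1), of "1 / norm s"] closure_subset[of \<Gamma>] by (auto intro: span_scale)
      from e(2)[OF this] False have "e * norm s \<le> s \<bullet> grad_log a"
        by (simp add: field_simps)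
      moreover have "\<bar>(z - grad_log a) \<bullet> s\<bar> \<le> norm (z - grad_log a) * norm s"
        by (rule Cauchy_Schwarz_ineq2)
      moreover have "norm (z - grad_log a) * norm s \<le> e * norm s"
        using z(2) by (intro mult_right_mono) (auto simp: dist_norm norm_minus_commute)
      moreover have "(z - grad_log a) \<bullet> s = z \<bullet> s - s \<bullet> grad_log a"
        by (simp add: inner_diff_left inner_commute[of s])
      ultimately show ?thesis unfolding zx by linarith
    qed (simp add: zx)
  qed
  then have "?S \<inter> ball (grad_log a) e \<subseteq> polar_cone \<Gamma>" by auto
  moreover have "openin (top_of_set ?S) (?S \<inter> ball (grad_log a) e)" by (auto intro: openin_open_Int)
  moreover have "grad_log a \<in> ?S \<inter> ball (grad_log a) e"
    using e(1) span_base[OF grad_log_in_polar[OF a]] by simp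
  ultimately show ?thesis
    unfolding open_polar_def interior_of_def by blast
qed

lemma open_polar_coercive:
  assumes "B \<in> open_polar \<Gamma>"
  obtains e where "e > 0" "\<And>x. x \<in> closure \<Gamma> \<Longrightarrow> x \<in> span (polar_cone \<Gamma>) \<Longrightarrow> e * norm x \<le> B \<bullet> x"
proof -
  let ?S = "span (polar_cone \<Gamma>)"
  obtain T where T: "openin (top_of_set ?S) T" "B \<in> T" "T \<subseteq> polar_cone \<Gamma>"
    using assms unfolding open_polar_def interior_of_def by blast
  obtain U where U: "open U" "T = ?S \<inter> U" using T(1) by (auto simp: openin_open)
  obtain e where e: "e > 0" "ball B e \<subseteq> U" using U T(2) by (meson IntD2 open_contains_ball)
  have "(e / 2) * norm x \<le> B \<bullet> x" if x: "x \<in> closure \<Gamma>" "x \<in> ?S" for x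
  proof (cases "x = 0")
    case False
    let ?z = "B - (e / (2 * norm x)) *\<^sub>R x"
    have "?z \<in> ball B e" using e(1) False by (simp add: dist_norm)
    moreover have "?z \<in> ?S" using T(2) U(2) x(2) by (auto intro: span_diff span_scale)
    ultimately have "?z \<in> polar_cone \<Gamma>" using e T U by blast
    from inner_polar_closure[OF this x(1)] have "(e / (2 * norm x)) * (x \<bullet> x) \<le> B \<bullet> x"
      by (simp add: inner_diff_left)
    also have "(e / (2 * norm x)) * (x \<bullet> x) = (e / 2) * norm x"
      using False by (simp add: power2_norm_eq_inner[symmetric] power2_eq_square)
    finally show ?thesis .
  qed simp
  then show ?thesis using e(1) that[of "e / 2"] by simp
qed

text \<open>A preimage of \<open>B\<close> maximizes \<open>g\<close> on the slice \<open>B \<bullet> x = N\<close> of the closed cone. Within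
  the span of the polar the slice is compact, since \<open>B\<close> is coercive there, so a maximizer \<open>A\<close>
  exists, and \<open>g A > 0\<close> puts it into the open cone. By homogeneity and invariance under the edge,
  \<open>A\<close> then maximizes \<open>ln (g x) - N * ln (B \<bullet> x)\<close> over the whole open cone, and its derivative
  there, \<open>grad_log A - B\<close>, vanishes.\<close>
lemma grad_log_surj:
  assumes B: "B \<in> open_polar \<Gamma>"
  obtains a where "a \<in> \<Gamma>" "grad_log a = B"
proof -
  let ?S = "span (polar_cone \<Gamma>)"
  obtain e where e: "e > 0" "\<And>x. x \<in> closure \<Gamma> \<Longrightarrow> x \<in> ?S \<Longrightarrow> e * norm x \<le> B \<bullet> x"
    using open_polar_coercive[OF B] by blast
  \<comment> \<open>The value \<open>N\<close> of the slice is the one that \<open>A \<bullet> grad_log A\<close> must have.\<close>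
  let ?K = "closure \<Gamma> \<inter> ?S \<inter> {x. B \<bullet> x = real N}"
  have "bounded ?K"
    unfolding bounded_iff
  proof (intro exI ballI)
    fix x assume "x \<in> ?K"
    then show "norm x \<le> real N / e" using e(1) e(2)[of x] by (simp add: field_simps)
  qed
  moreover have "closed ?K"
    by (intro closed_Int closed_closure closed_span closed_Collect_eq continuous_intros)
  ultimately have "compact ?K" by (simp add: compact_eq_bounded_closed)
  have Bpos: "B \<bullet> s > 0" if "s \<in> \<Gamma>" "s \<in> ?S" for s
  proof -
    have "g 0 = 0" using hom[of 0 0] N by (simp add: power_0_left)
    then have "s \<noteq> 0" using pos[OF that(1)] by auto
    then show ?thesis using e(1) e(2)[of s] that closure_subset[of \<Gamma>]
      by (smt (verit) mult_pos_pos subsetD zero_less_norm_iff)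
  qed
  have normalize: "(real N / (B \<bullet> s)) *\<^sub>R s \<in> ?K \<inter> \<Gamma>" if s: "s \<in> \<Gamma>" "s \<in> ?S" for s
    using Bpos[OF s] scale[OF s(1), of "real N / (B \<bullet> s)"] closure_subset[of \<Gamma>] s N
    by (auto intro: span_scale)
  obtain x0 where "x0 \<in> \<Gamma>" by (rule cone_nonempty)
  then obtain s0 where s0: "s0 \<in> \<Gamma>" "s0 \<in> ?S" by (rule project_cone)
  let ?k0 = "(real N / (B \<bullet> s0)) *\<^sub>R s0"
  have "?K \<noteq> {}" using normalize[OF s0] by blast
  then obtain A where A: "A \<in> ?K" "\<And>x. x \<in> ?K \<Longrightarrow> g x \<le> g A"
    using continuous_attains_sup[OF \<open>compact ?K\<close> _ continuous_on_real_polynomial_function[OF poly]] by blast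
  have "g A > 0" using A(2)[of ?k0] pos[of ?k0] normalize[OF s0] by auto
  then have A\<Gamma>: "A \<in> \<Gamma>" using in_cone_if_pos A(1) by blast
  have BA: "B \<bullet> A = real N" using A(1) by simp
  have Bpos': "B \<bullet> x > 0" and max: "ln (g x) - real N * ln (B \<bullet> x) \<le> ln (g A) - real N * ln (B \<bullet> A)"
    if x: "x \<in> \<Gamma>" for x
  proof -
    obtain s v where s: "s \<in> \<Gamma>" "s \<in> ?S" "v \<in> edge \<Gamma>" "x = s + v" "g s = g x"
      using x by (rule project_cone)
    have Bx: "B \<bullet> x = B \<bullet> s"
      using inner_polar_edge[OF _ s(3)] B open_polar_subset s(4) by (auto simp: inner_add_right)
    then show "B \<bullet> x > 0" using Bpos s by simp
    have "(real N / (B \<bullet> s)) ^ N * g x \<le> g A"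
      using A(2)[of "(real N / (B \<bullet> s)) *\<^sub>R s"] normalize[OF s(1,2)] by (simp add: hom s(5))
    moreover have q: "real N / (B \<bullet> s) > 0" using Bpos[OF s(1,2)] N by simp
    ultimately have "ln ((real N / (B \<bullet> s)) ^ N * g x) \<le> ln (g A)"
      using pos[OF x] \<open>g A > 0\<close> by (subst ln_le_cancel_iff) auto
    moreover have "ln (r ^ N * y) = real N * ln r + ln y" if "r > 0" "y > 0" for r y :: real
      using that by (simp add: ln_mult ln_realpow)
    ultimately have "real N * ln (real N / (B \<bullet> s)) + ln (g x) \<le> ln (g A)"
      using q pos[OF x] by simp
    then show "ln (g x) - real N * ln (B \<bullet> x) \<le> ln (g A) - real N * ln (B \<bullet> A)"
      using Bpos[OF s(1,2)] N by (simp add: BA Bx ln_div algebra_simps)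
  qed
  have "GDERIV (\<lambda>x. B \<bullet> x) A :> B"
    unfolding gderiv_def by (auto intro!: derivative_eq_intros simp: inner_commute)
  then have "GDERIV (\<lambda>x. ln (B \<bullet> x)) A :> inverse (B \<bullet> A) *\<^sub>R B"
    using BA N by (intro GDERIV_DERIV_compose DERIV_ln) auto
  then have "GDERIV (\<lambda>x. real N * ln (B \<bullet> x)) A :> real N *\<^sub>R (inverse (B \<bullet> A) *\<^sub>R B) + ln (B \<bullet> A) *\<^sub>R 0"
    by (intro GDERIV_mult GDERIV_const)
  then have "GDERIV (\<lambda>x. real N * ln (B \<bullet> x)) A :> B"
    using BA N by simp
  then have "GDERIV (\<lambda>x. ln (g x) - real N * ln (B \<bullet> x)) A :> grad_log A - B"
    by (intro GDERIV_diff GDERIV_grad_log A\<Gamma>)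
  then have "(\<lambda>h. h \<bullet> (grad_log A - B)) = (\<lambda>h. 0)"
    unfolding gderiv_def
    using max by (intro differential_zero_maxmin[OF A\<Gamma> open_cone]) auto
  then have "(grad_log A - B) \<bullet> (grad_log A - B) = 0" by meson
  then show ?thesis using that[OF A\<Gamma>] by simp
qed

section \<open>The inequality between a form and its dual\<close>

lemma GDERIV_root:
  assumes a: "a \<in> \<Gamma>"
  shows "GDERIV (\<lambda>x. root N (g x)) a :> (root N (g a) / real N) *\<^sub>R grad_log a"
proof -
  let ?r = "root N (g a)"
  obtain D where D: "GDERIV g a :> D" by (rule GDERIV_g)
  then have "GDERIV (\<lambda>z. ln (g z)) a :> inverse (g a) *\<^sub>R D"
    using pos[OF a] by (intro GDERIV_DERIV_compose DERIV_ln) auto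
  then have grad_log: "grad_log a = inverse (g a) *\<^sub>R D" unfolding grad_log_def by (rule gradient_eqI)
  have r: "?r > 0" and rN: "?r ^ N = g a" using pos[OF a] N by simp_all
  have "GDERIV (\<lambda>x. root N (g x)) a :> inverse (real N * ?r ^ (N - Suc 0)) *\<^sub>R D"
    using pos[OF a] N by (intro GDERIV_DERIV_compose[OF D] DERIV_real_root) auto
  moreover have "inverse (real N * ?r ^ (N - Suc 0)) = ?r / real N * inverse (g a)"
  proof -
    have "g a = ?r * ?r ^ (N - Suc 0)"
      using N by (subst rN[symmetric]) (simp add: power_eq_if)
    then show ?thesis using r N by (simp add: field_simps)
  qed
  ultimately show ?thesis unfolding grad_log by (simp only: scaleR_scaleR)
qed

text \<open>Vectors in the span of the polar that are congruent modulo the edge are equal, as their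
  difference is orthogonal to itself.\<close>
lemma eq_scaled_grad_log_if_diff_in_edge:
  assumes a: "a \<in> \<Gamma>" and B: "B \<in> open_polar \<Gamma>" and "B - c *\<^sub>R grad_log a \<in> edge \<Gamma>"
  shows "B = c *\<^sub>R grad_log a"
proof -
  have "B - c *\<^sub>R grad_log a \<in> span (polar_cone \<Gamma>)"
    using B open_polar_subset grad_log_in_polar[OF a] by (intro span_diff span_scale span_base) auto
  from inner_span_edge[OF this assms(3)] show ?thesis by simp
qed

lemma root_dual_scaled_grad_log:
  assumes a: "a \<in> \<Gamma>" and c: "c > 0"
  shows "root N (dual_garding g \<Gamma> (c *\<^sub>R grad_log a)) = c / root N (g a)"
proof -
  have "c *\<^sub>R grad_log a = grad_log ((1 / c) *\<^sub>R a)"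
    using grad_log_scale[OF a, of "1 / c"] c by simp
  then have "dual_garding g \<Gamma> (c *\<^sub>R grad_log a) = 1 / g ((1 / c) *\<^sub>R a)"
    using dual_garding_grad_log[OF scale[OF a, of "1 / c"]] c by simp
  also have "\<dots> = c ^ N / g a" using c by (simp add: hom power_one_over)
  finally show ?thesis using c N by (simp add: real_root_divide real_root_power_cancel)
qed

lemma garding_inequality:
  assumes a: "a \<in> \<Gamma>" and B: "B \<in> open_polar \<Gamma>"
  shows "root N (g a) * root N (dual_garding g \<Gamma> B) \<le> 1 / real N * (a \<bullet> B)"
    and "root N (g a) * root N (dual_garding g \<Gamma> B) = 1 / real N * (a \<bullet> B) \<longleftrightarrow>
           (\<exists>c>0. B - c *\<^sub>R grad_log a \<in> edge \<Gamma>)"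
    and "c > 0 \<Longrightarrow> B - c *\<^sub>R grad_log a \<in> edge \<Gamma> \<Longrightarrow> a \<bullet> B = c * real N"
proof -
  obtain x where x: "x \<in> \<Gamma>" and B_eq: "grad_log x = B" using B by (rule grad_log_surj)
  have ra: "root N (g a) > 0" and rx: "root N (g x) > 0" using pos a x N by simp_all
  have dual: "root N (dual_garding g \<Gamma> B) = 1 / root N (g x)"
    using dual_garding_grad_log[OF x] N unfolding B_eq by (simp add: real_root_divide)
  have rearrange: "u * (1 / v) \<le> 1 / real N * w \<longleftrightarrow> u \<le> v * (w / real N)"
      "u * (1 / v) = 1 / real N * w \<longleftrightarrow> u = v * (w / real N)" if "v > 0" for u v w :: real
    using that N by (auto simp: field_simps)
  show "root N (g a) * root N (dual_garding g \<Gamma> B) \<le> 1 / real N * (a \<bullet> B)"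
    unfolding dual rearrange[OF rx] using root_le_inner_grad_log(1)[OF a x] unfolding B_eq .
  show inner: "a \<bullet> B = c * real N" if "c > 0" "B - c *\<^sub>R grad_log a \<in> edge \<Gamma>" for c
    unfolding eq_scaled_grad_log_if_diff_in_edge[OF a B that(2)] by (simp add: inner_grad_log_self a)
  show "root N (g a) * root N (dual_garding g \<Gamma> B) = 1 / real N * (a \<bullet> B) \<longleftrightarrow>
           (\<exists>c>0. B - c *\<^sub>R grad_log a \<in> edge \<Gamma>)"
  proof
    assume "root N (g a) * root N (dual_garding g \<Gamma> B) = 1 / real N * (a \<bullet> B)"
    then have eq: "root N (g a) = root N (g x) * (a \<bullet> B / real N)"
      unfolding dual rearrange[OF rx] .
    then have "a \<bullet> B / real N > 0"
      using ra rx by (simp only: zero_less_mult_iff) linarith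
    moreover have "B = (a \<bullet> B / real N) *\<^sub>R grad_log a"
      using root_le_inner_grad_log(2)[OF a x] eq unfolding B_eq by blast
    then have "B - (a \<bullet> B / real N) *\<^sub>R grad_log a = 0" by (simp only: right_minus_eq)
    then have "B - (a \<bullet> B / real N) *\<^sub>R grad_log a \<in> edge \<Gamma>"
      by (simp only: edge_iff minus_zero zero_in_closure simp_thms)
    ultimately show "\<exists>c>0. B - c *\<^sub>R grad_log a \<in> edge \<Gamma>" by blast
  next
    assume "\<exists>c>0. B - c *\<^sub>R grad_log a \<in> edge \<Gamma>"
    then obtain c where c: "c > 0" "B - c *\<^sub>R grad_log a \<in> edge \<Gamma>" by blast
    have "root N (dual_garding g \<Gamma> B) = c / root N (g a)"
      using root_dual_scaled_grad_log[OF a c(1)] eq_scaled_grad_log_if_diff_in_edge[OF a B c(2)] by simp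
    then show "root N (g a) * root N (dual_garding g \<Gamma> B) = 1 / real N * (a \<bullet> B)"
      using ra N inner[OF c] by simp
  qed
qed

lemma normalized_garding_inequality:
  assumes a: "a \<in> \<Gamma>" and B: "B \<in> open_polar \<Gamma>" and 1: "dual_garding g \<Gamma> B = 1"
  shows "root N (g a) \<le> 1 / real N * (B \<bullet> a)"
    and "root N (g a) = 1 / real N * (B \<bullet> a) \<longleftrightarrow>
           B - real N *\<^sub>R gradient (\<lambda>x. root N (g x)) a \<in> edge \<Gamma>"
proof -
  have ra: "root N (g a) > 0" using pos a N by simp
  have grad: "real N *\<^sub>R gradient (\<lambda>x. root N (g x)) a = root N (g a) *\<^sub>R grad_log a"
    using N by (simp add: gradient_eqI[OF GDERIV_root[OF a]])
  note ineq = garding_inequality[OF a B, unfolded 1]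
  show "root N (g a) \<le> 1 / real N * (B \<bullet> a)"
    using ineq(1) N by (simp add: inner_commute)
  have iff: "root N (g a) = 1 / real N * (B \<bullet> a) \<longleftrightarrow> (\<exists>c>0. B - c *\<^sub>R grad_log a \<in> edge \<Gamma>)"
    using ineq(2) N by (simp add: inner_commute)
  show "root N (g a) = 1 / real N * (B \<bullet> a) \<longleftrightarrow>
           B - real N *\<^sub>R gradient (\<lambda>x. root N (g x)) a \<in> edge \<Gamma>"
    unfolding grad
  proof
    assume eq: "root N (g a) = 1 / real N * (B \<bullet> a)"
    then obtain c where c: "c > 0" "B - c *\<^sub>R grad_log a \<in> edge \<Gamma>" using iff by blast
    have "B \<bullet> a = c * real N" using ineq(3)[OF c] by (simp only: inner_commute)
    then have "root N (g a) = c" using eq N by simp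
    with c(2) show "B - root N (g a) *\<^sub>R grad_log a \<in> edge \<Gamma>" by simp
  qed (use iff ra in blast)
qed

text \<open>For \<open>A\<close> in the open cone the infimum is attained at \<open>root N (g A) *\<^sub>R grad_log A\<close>. For \<open>A\<close> in
  the closure this is applied to the points \<open>x n = A + a / (n + 1)\<close> of the cone: their minimizers pair
  nonnegatively with \<open>a\<close>, so the pairing with \<open>A\<close> is at most the one with \<open>x n\<close>, which
  is \<open>N * root N (g (x n))\<close>.\<close>
lemma root_eq_INF:
  assumes A: "A \<in> closure \<Gamma>"
  shows "root N (g A) = (INF B\<in>{B \<in> open_polar \<Gamma>. dual_garding g \<Gamma> B = 1}. 1 / real N * (B \<bullet> A))"
    (is "_ = (INF B\<in>?D. ?f B)")
proof -
  obtain a where a: "a \<in> \<Gamma>" by (rule cone_nonempty)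
  define x where "x n = A + inverse (real (Suc n)) *\<^sub>R a" for n
  have x: "x n \<in> \<Gamma>" for n
  proof -
    have "inverse (real (Suc n)) *\<^sub>R a + A \<in> \<Gamma>" by (intro add_closure scale a A) simp
    then show ?thesis by (simp only: x_def add.commute)
  qed
  have "(\<lambda>n. A + inverse (real (Suc n)) *\<^sub>R a) \<longlonglongrightarrow> A + 0 *\<^sub>R a"
    by (intro tendsto_intros LIMSEQ_inverse_real_of_nat)
  then have x_lim: "x \<longlonglongrightarrow> A" unfolding x_def by simp
  have "isCont g A"
    using continuous_on_real_polynomial_function[OF poly, of UNIV] by (simp add: continuous_on_eq_continuous_at)
  then have "(\<lambda>n. g (x n)) \<longlonglongrightarrow> g A" using x_lim by (rule isCont_tendsto_compose)
  then have root_lim: "(\<lambda>n. root N (g (x n))) \<longlonglongrightarrow> root N (g A)" by (rule tendsto_real_root)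
  have lower: "root N (g A) \<le> ?f B" if B: "B \<in> ?D" for B
  proof (rule LIMSEQ_le[OF root_lim])
    show "(\<lambda>n. 1 / real N * (B \<bullet> x n)) \<longlonglongrightarrow> ?f B"
      by (intro tendsto_intros x_lim)
    show "\<exists>n0. \<forall>n\<ge>n0. root N (g (x n)) \<le> 1 / real N * (B \<bullet> x n)"
      using normalized_garding_inequality(1)[OF x] B by blast
  qed
  have bdd: "bdd_below (?f ` ?D)" using lower by (rule bdd_belowI2)
  have near: "\<exists>B\<in>?D. ?f B \<le> root N (g (x n))" for n
  proof -
    let ?r = "root N (g (x n))"
    have r: "?r > 0" using pos[OF x] N by simp
    let ?B = "?r *\<^sub>R grad_log (x n)"
    have B: "?B = grad_log ((1 / ?r) *\<^sub>R x n)" using grad_log_scale[OF x, of "1 / ?r" n] r by simp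
    have y: "(1 / ?r) *\<^sub>R x n \<in> \<Gamma>" using r by (intro scale x) simp
    have "dual_garding g \<Gamma> ?B = 1 / g ((1 / ?r) *\<^sub>R x n)"
      unfolding B by (rule dual_garding_grad_log[OF y])
    also have "g ((1 / ?r) *\<^sub>R x n) = 1"
      using pos[OF x, of n] N by (simp add: hom power_one_over)
    finally have "dual_garding g \<Gamma> ?B = 1" by simp
    moreover have "?B \<in> open_polar \<Gamma>" unfolding B by (rule grad_log_in_open_polar[OF y])
    ultimately have "?B \<in> ?D" by blast
    moreover have "?f ?B \<le> ?r"
    proof -
      have "A \<bullet> grad_log (x n) = real N - inverse (real (Suc n)) * (a \<bullet> grad_log (x n))"
        using inner_grad_log_self[OF x, of n] by (simp add: x_def inner_add_left)
      moreover have "a \<bullet> grad_log (x n) \<ge> 0"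
        using inner_grad_log_nonneg[OF x] a closure_subset by blast
      ultimately have "A \<bullet> grad_log (x n) \<le> real N" by (simp del: of_nat_Suc)
      then show ?thesis using r N by (simp add: inner_commute field_simps)
    qed
    ultimately show ?thesis by blast
  qed
  show ?thesis
  proof (rule antisym)
    show "root N (g A) \<le> (INF B\<in>?D. ?f B)"
      using near[of 0] lower by (intro cINF_greatest) auto
    show "(INF B\<in>?D. ?f B) \<le> root N (g A)"
    proof (rule LIMSEQ_le_const[OF root_lim], intro exI allI impI)
      fix n :: nat
      obtain B where "B \<in> ?D" "?f B \<le> root N (g (x n))" using near by blast
      then show "(INF B\<in>?D. ?f B) \<le> root N (g (x n))"
        using cINF_lower[OF bdd] by (meson order_trans)
    qed
  qed
qed

end

theorem theorem12p1:
  fixes g :: "'a::euclidean_space \<Rightarrow> real" and \<Gamma> :: "'a set" and N :: nat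
  assumes "N \<ge> 1" and "garding_polynomial N g \<Gamma>"
  shows
    "(\<forall>A\<in>\<Gamma>. \<forall>B\<in>open_polar \<Gamma>.
        root N (g A) * root N (dual_garding g \<Gamma> B) \<le> 1 / real N * (A \<bullet> B) \<and>
        (root N (g A) * root N (dual_garding g \<Gamma> B) = 1 / real N * (A \<bullet> B) \<longleftrightarrow>
           (\<exists>c>0. B - c *\<^sub>R gradient (\<lambda>x. ln (g x)) A \<in> edge \<Gamma>)) \<and>
        (\<forall>c>0. B - c *\<^sub>R gradient (\<lambda>x. ln (g x)) A \<in> edge \<Gamma> \<longrightarrow> A \<bullet> B = c * real N)) \<and>
     (\<forall>A\<in>\<Gamma>. \<forall>B\<in>open_polar \<Gamma>. dual_garding g \<Gamma> B = 1 \<longrightarrow>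
        root N (g A) \<le> 1 / real N * (B \<bullet> A) \<and>
        (root N (g A) = 1 / real N * (B \<bullet> A) \<longleftrightarrow>
           B - real N *\<^sub>R gradient (\<lambda>x. root N (g x)) A \<in> edge \<Gamma>)) \<and>
     (\<forall>A\<in>closure \<Gamma>.
        root N (g A) = (INF B\<in>{B \<in> open_polar \<Gamma>. dual_garding g \<Gamma> B = 1}. 1 / real N * (B \<bullet> A)))"
proof -
  interpret garding_cone N g \<Gamma>
    using assms by (rule garding_polynomial_imp_garding_cone)
  show ?thesis
    unfolding grad_log_def[symmetric]
    using garding_inequality normalized_garding_inequality root_eq_INF by blast
qed

end
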